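(* Let $C_1\ge 1$. Assume that for every $\eta\in\mathcal H$ one has, $\mu$-almost everywhere in $x$, $$\|e^{t\vec\Delta}\eta\|_{\mathcal H_x}\le C_1\,\bigl(e^{t\Delta}\|\eta\|_{\mathcal H_\cdot}\bigr)(x),\qquad 0\le t\le 1 .$$ Then there is $C_2\in\mathbb R$ such that the semigroup $e^{t\Delta}$ satisfies the Bakry–Émery estimate $$\sqrt{\Gamma(e^{t\Delta}f)}\le C_1e^{C_2t}\,e^{t\Delta}\sqrt{\Gamma(f)}\quad \mu\text{-a.e.},\qquad f\in\operatorname{Dom}\mathcal E,\ t\ge0 .$$
   Context: Setting. $(X,d)$ is a locally compact separable metric space and $\mu$ is a locally finite Borel measure on $X$ with $\mu(U)>0$ for every nonempty open $U$. $(\mathcal E,\operatorname{Dom}\mathcal E)$ is a symmetric, strictly local (i.e. strongly local: $\mathcal E(f,g)=0$ whenever $f,g\in\operatorname{Dom}\mathcal E$ have compact support and $g$ is constant on a neighbourhood of $\operatorname{supp} f$), regular Dirichlet form on $L^2(X,\mu)$. It admits a carré du champ $\Gamma$: a symmetric bilinear positive map $\operatorname{Dom}\mathcal E\times\operatorname{Dom}\mathcal E\to L^1(X,\mu)$ with $\mathcal E(f,g)=\int\Gamma(f,g)\,d\mu$ and $2\int h\,\Gamma(f,g)\,d\mu=\mathcal E(fh,g)+\mathcal E(gh,f)-\mathcal E(fg,h)$ for bounded $f,g,h\in\operatorname{Dom}\mathcal E$; $\Gamma(f):=\Gamma(f,f)$. $\Delta$ is the nonpositive self-adjoint generator: $\mathcal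 E(u,v)=-\int v\,\Delta u\,d\mu$ for $u\in\operatorname{Dom}\Delta$, $v\in\operatorname{Dom}\mathcal E$. One-forms. Let $\mathcal B_b(X)$ be the bounded Borel functions and $\mathcal C=C_b(X)\cap\operatorname{Dom}\mathcal E$. $\mathcal H$ is the Hilbert space obtained from $\mathcal C\otimes\mathcal B_b(X)$ with the nonnegative form $\langle f_1\otimes g_1,f_2\otimes g_2\rangle_{\mathcal H}=\int g_1g_2\,\Gamma(f_1,f_2)\,d\mu$ by quotienting out the zero-seminorm elements and completing. $\partial f=f\otimes\mathbf 1$ for $f\in\mathcal C$, extended to a closed densely defined operator $\partial:L^2(X,\mu)\to\mathcal H$ with $\operatorname{Dom}\partial=\operatorname{Dom}\mathcal E$. $\partial^*$ is its adjoint, and $\vec\Delta=-\partial\partial^*$ is the self-adjoint one-form Laplacian on $\mathcal H$, with domain $\{\eta\in\operatorname{Dom}\partial^*:\partial^*\eta\in\operatorname{Dom}\partial\}$. Fibres. $\mathcal H$ is isometric to a direct integral $\int_X^\oplus\mathcal H_x\,d\mu(x)$, where the fibrewise inner product is determined by $\langle f_1\otimes g_1,f_2\otimes g_2\rangle_{\mathcal H_x}=g_1(x)g_2(x)\Gamma(f_1,f_2)(x)$; so $\|\eta\|_{\mathcal H}^2=\int\|\eta\|_{\mathcal H_x}^2d\mu(x)$, and $\|\partial f\|_{\mathcal H_x}=\sqrt{\Gamma(f)(x)}$. $\|\eta\|_{\mathcal H_\cdot}$ denotes the function $x\mapsto\|\eta\|_{\mathcal H_x}$. *)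

theory Defs
  imports "HOL-Analysis.Analysis"
begin

text \<open>
  Elements of \<open>L\<^sup>2(X,\<mu>)\<close> and \<open>L\<^sup>1(X,\<mu>)\<close> are represented by functions on \<open>X\<close>; all identities between
  them are almost everywhere. The space \<open>X\<close> is the type \<open>'a\<close>; for a metric space,
  separability is the type class \<open>second_countable_topology\<close>.
\<close>

section \<open>Square-integrable functions\<close>

definition L2 :: "'a measure \<Rightarrow> ('a \<Rightarrow> real) set" where
  "L2 M = {f \<in> borel_measurable M. integrable M (\<lambda>x. (f x)\<^sup>2)}"

definition l2norm :: "'a measure \<Rightarrow> ('a \<Rightarrow> real) \<Rightarrow> real" where
  "l2norm M f = sqrt (\<integral>x. (f x)\<^sup>2 \<partial>M)"

definition l2inner :: "'a measure \<Rightarrow> ('a \<Rightarrow> real) \<Rightarrow> ('a \<Rightarrow> real) \<Rightarrow> real" where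
  "l2inner M f g = (\<integral>x. f x * g x \<partial>M)"

definition ess_bounded :: "'a measure \<Rightarrow> ('a \<Rightarrow> real) \<Rightarrow> bool" where
  "ess_bounded M f \<longleftrightarrow> (\<exists>B. AE x in M. \<bar>f x\<bar> \<le> B)"

text \<open>The support of (the class of) a measurable function: the complement of the largest open set
  on which it vanishes almost everywhere.\<close>

definition ess_supp :: "'a::topological_space measure \<Rightarrow> ('a \<Rightarrow> real) \<Rightarrow> 'a set" where
  "ess_supp M f = - \<Union>{U. open U \<and> (AE x in M. x \<in> U \<longrightarrow> f x = 0)}"

definition Cc :: "('a::topological_space \<Rightarrow> real) set" where
  "Cc = {f. continuous_on UNIV f \<and> compact (closure {x. f x \<noteq> 0})}"

definition Bb :: "('a::topological_space \<Rightarrow> real) set" where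
  "Bb = {g \<in> borel_measurable borel. bounded (range g)}"

section \<open>Dirichlet forms\<close>

definition E1norm ::
  "'a measure \<Rightarrow> (('a \<Rightarrow> real) \<Rightarrow> ('a \<Rightarrow> real) \<Rightarrow> real) \<Rightarrow> ('a \<Rightarrow> real) \<Rightarrow> real" where
  "E1norm M E f = sqrt (E f f + (l2norm M f)\<^sup>2)"

locale metric_measure_space =
  fixes M :: "'a::{metric_space, second_countable_topology} measure"
  assumes locally_compact: "locally compact (UNIV :: 'a set)"
    and borel: "sets M = sets borel"
    and locally_finite: "\<exists>U. open U \<and> x \<in> U \<and> emeasure M U < \<infinity>"
    and full_support: "open U \<Longrightarrow> U \<noteq> {} \<Longrightarrow> emeasure M U > 0"

locale dirichlet_form = metric_measure_space M
  for M :: "'a::{metric_space, second_countable_topology} measure" +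
  fixes D :: "('a \<Rightarrow> real) set"  \<comment> \<open>\<open>Dom \<E>\<close>\<close>
    and E :: "('a \<Rightarrow> real) \<Rightarrow> ('a \<Rightarrow> real) \<Rightarrow> real"
  assumes D_L2: "D \<subseteq> L2 M"
    and D_cong: "f \<in> D \<Longrightarrow> g \<in> L2 M \<Longrightarrow> (AE x in M. f x = g x) \<Longrightarrow> g \<in> D"
    and D_add: "f \<in> D \<Longrightarrow> g \<in> D \<Longrightarrow> (\<lambda>x. f x + g x) \<in> D"
    and D_scale: "f \<in> D \<Longrightarrow> (\<lambda>x. c * f x) \<in> D"
    and D_dense: "f \<in> L2 M \<Longrightarrow> \<epsilon> > 0 \<Longrightarrow> \<exists>g\<in>D. l2norm M (\<lambda>x. f x - g x) < \<epsilon>"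
    and E_cong: "f \<in> D \<Longrightarrow> g \<in> D \<Longrightarrow> h \<in> D \<Longrightarrow> (AE x in M. f x = g x) \<Longrightarrow> E f h = E g h"
    and E_sym: "f \<in> D \<Longrightarrow> g \<in> D \<Longrightarrow> E f g = E g f"
    and E_add: "f \<in> D \<Longrightarrow> g \<in> D \<Longrightarrow> h \<in> D \<Longrightarrow> E (\<lambda>x. f x + g x) h = E f h + E g h"
    and E_scale: "f \<in> D \<Longrightarrow> h \<in> D \<Longrightarrow> E (\<lambda>x. c * f x) h = c * E f h"
    and E_nonneg: "f \<in> D \<Longrightarrow> E f f \<ge> 0"
    and E_closed: "(\<And>n. u n \<in> D) \<Longrightarrow>
        (\<And>\<epsilon>. \<epsilon> > 0 \<Longrightarrow> \<exists>N. \<forall>m\<ge>N. \<forall>n\<ge>N. E1norm M E (\<lambda>x. u m x - u n x) < \<epsilon>) \<Longrightarrow>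
        \<exists>v\<in>D. (\<lambda>n. E1norm M E (\<lambda>x. u n x - v x)) \<longlonglongrightarrow> 0"
    and markov_D: "f \<in> D \<Longrightarrow> (\<lambda>x. min (max (f x) 0) 1) \<in> D"
    and markov_E: "f \<in> D \<Longrightarrow>
        E (\<lambda>x. min (max (f x) 0) 1) (\<lambda>x. min (max (f x) 0) 1) \<le> E f f"

locale regular_strongly_local_dirichlet_form = dirichlet_form M D E
  for M :: "'a::{metric_space, second_countable_topology} measure" and D E +
  assumes regular_D: "f \<in> D \<Longrightarrow> \<epsilon> > 0 \<Longrightarrow> \<exists>g \<in> D \<inter> Cc. E1norm M E (\<lambda>x. f x - g x) < \<epsilon>"
    and regular_Cc: "f \<in> Cc \<Longrightarrow> \<epsilon> > 0 \<Longrightarrow> \<exists>g \<in> D \<inter> Cc. \<forall>x. \<bar>f x - g x\<bar> < \<epsilon>"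
    and strongly_local: "f \<in> D \<Longrightarrow> g \<in> D \<Longrightarrow> compact (ess_supp M f) \<Longrightarrow> compact (ess_supp M g) \<Longrightarrow>
        open U \<Longrightarrow> ess_supp M f \<subseteq> U \<Longrightarrow> (AE x in M. x \<in> U \<longrightarrow> g x = c) \<Longrightarrow> E f g = 0"

locale carre_du_champ = regular_strongly_local_dirichlet_form M D E
  for M :: "'a::{metric_space, second_countable_topology} measure" and D E +
  fixes \<Gamma> :: "('a \<Rightarrow> real) \<Rightarrow> ('a \<Rightarrow> real) \<Rightarrow> 'a \<Rightarrow> real"
  assumes \<Gamma>_L1: "f \<in> D \<Longrightarrow> g \<in> D \<Longrightarrow> integrable M (\<Gamma> f g)"
    and \<Gamma>_sym: "f \<in> D \<Longrightarrow> g \<in> D \<Longrightarrow> AE x in M. \<Gamma> f g x = \<Gamma> g f x"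
    and \<Gamma>_add: "f \<in> D \<Longrightarrow> g \<in> D \<Longrightarrow> h \<in> D \<Longrightarrow>
        AE x in M. \<Gamma> (\<lambda>x. f x + g x) h x = \<Gamma> f h x + \<Gamma> g h x"
    and \<Gamma>_scale: "f \<in> D \<Longrightarrow> h \<in> D \<Longrightarrow> AE x in M. \<Gamma> (\<lambda>x. c * f x) h x = c * \<Gamma> f h x"
    and \<Gamma>_nonneg: "f \<in> D \<Longrightarrow> AE x in M. \<Gamma> f f x \<ge> 0"
    and \<Gamma>_energy: "f \<in> D \<Longrightarrow> g \<in> D \<Longrightarrow> E f g = (\<integral>x. \<Gamma> f g x \<partial>M)"
    and \<Gamma>_product: "f \<in> D \<Longrightarrow> g \<in> D \<Longrightarrow> h \<in> D \<Longrightarrow>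
        ess_bounded M f \<Longrightarrow> ess_bounded M g \<Longrightarrow> ess_bounded M h \<Longrightarrow>
        2 * (\<integral>x. h x * \<Gamma> f g x \<partial>M) =
          E (\<lambda>x. f x * h x) g + E (\<lambda>x. g x * h x) f - E (\<lambda>x. f x * g x) h"

text \<open>The graph of the generator: \<open>laplacian M D E u w\<close> means \<open>u \<in> Dom \<Delta>\<close> and \<open>\<Delta> u = w\<close>.\<close>

definition laplacian ::
  "'a measure \<Rightarrow> ('a \<Rightarrow> real) set \<Rightarrow> (('a \<Rightarrow> real) \<Rightarrow> ('a \<Rightarrow> real) \<Rightarrow> real) \<Rightarrow>
   ('a \<Rightarrow> real) \<Rightarrow> ('a \<Rightarrow> real) \<Rightarrow> bool" where
  "laplacian M D E u w \<longleftrightarrow> u \<in> D \<and> w \<in> L2 M \<and> (\<forall>v\<in>D. E u v = - l2inner M v w)"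

section \<open>One-forms\<close>

definition core :: "('a::topological_space \<Rightarrow> real) set \<Rightarrow> ('a \<Rightarrow> real) set" where
  "core D = {f \<in> D. continuous_on UNIV f \<and> bounded (range f)}"

text \<open>
  The type \<open>'h\<close> is the completion of the quotient of \<open>\<C> \<otimes> \<B>\<^sub>b(X)\<close> by the null space of the
  form, and \<open>tens f g\<close> is the image of \<open>f \<otimes> g\<close> in it. This determines \<open>'h\<close> up to isometry;
  bilinearity of \<open>tens\<close> follows from that of \<open>\<Gamma>\<close>.
\<close>

locale one_forms = carre_du_champ M D E \<Gamma>
  for M :: "'a::{metric_space, second_countable_topology} measure" and D E \<Gamma> +
  fixes tens :: "('a \<Rightarrow> real) \<Rightarrow> ('a \<Rightarrow> real) \<Rightarrow> 'h::{real_inner, complete_space}"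
  assumes tens_inner:
      "f\<^sub>1 \<in> core D \<Longrightarrow> f\<^sub>2 \<in> core D \<Longrightarrow> g\<^sub>1 \<in> Bb \<Longrightarrow> g\<^sub>2 \<in> Bb \<Longrightarrow>
        tens f\<^sub>1 g\<^sub>1 \<bullet> tens f\<^sub>2 g\<^sub>2 = (\<integral>x. g\<^sub>1 x * g\<^sub>2 x * \<Gamma> f\<^sub>1 f\<^sub>2 x \<partial>M)"
    and tens_dense: "closure (span {tens f g | f g. f \<in> core D \<and> g \<in> Bb}) = UNIV"

text \<open>
  The closure of \<open>f \<mapsto> f \<otimes> 1\<close> as an operator from \<open>L\<^sup>2\<close> to \<open>'h\<close>. Its domain is \<open>D\<close>: closability and
  \<open>\<parallel>f \<otimes> 1\<parallel>\<^sup>2 = E f f\<close> on the core come from the closedness of \<open>E\<close>, and the core is dense in \<open>D\<close> by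
  regularity.
\<close>

definition dform ::
  "'a::topological_space measure \<Rightarrow> ('a \<Rightarrow> real) set \<Rightarrow>
   (('a \<Rightarrow> real) \<Rightarrow> ('a \<Rightarrow> real) \<Rightarrow> 'h::real_normed_vector) \<Rightarrow> ('a \<Rightarrow> real) \<Rightarrow> 'h" where
  "dform M D tens f = (THE \<eta>. \<exists>u. (\<forall>n::nat. u n \<in> core D) \<and>
      (\<lambda>n. l2norm M (\<lambda>x. u n x - f x)) \<longlonglongrightarrow> 0 \<and> (\<lambda>n. tens (u n) (\<lambda>_. 1)) \<longlonglongrightarrow> \<eta>)"

text \<open>Graphs of \<open>\<partial>\<^sup>*\<close> and of \<open>- \<partial> \<partial>\<^sup>*\<close>.\<close>

definition codiff ::
  "'a::topological_space measure \<Rightarrow> ('a \<Rightarrow> real) set \<Rightarrow>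
   (('a \<Rightarrow> real) \<Rightarrow> ('a \<Rightarrow> real) \<Rightarrow> 'h::real_inner) \<Rightarrow> 'h \<Rightarrow> ('a \<Rightarrow> real) \<Rightarrow> bool" where
  "codiff M D tens \<eta> w \<longleftrightarrow> w \<in> L2 M \<and> (\<forall>f\<in>D. dform M D tens f \<bullet> \<eta> = l2inner M f w)"

definition form_laplacian ::
  "'a::topological_space measure \<Rightarrow> ('a \<Rightarrow> real) set \<Rightarrow>
   (('a \<Rightarrow> real) \<Rightarrow> ('a \<Rightarrow> real) \<Rightarrow> 'h::real_inner) \<Rightarrow> 'h \<Rightarrow> 'h \<Rightarrow> bool" where
  "form_laplacian M D tens \<eta> \<zeta> \<longleftrightarrow>
     (\<exists>w. codiff M D tens \<eta> w \<and> w \<in> D \<and> \<zeta> = - dform M D tens w)"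

section \<open>Direct integrals\<close>

text \<open>
  A measurable field of Hilbert spaces. The fibres are complete subspaces of one
  inner product space \<open>'v\<close>, but no measurability relative to \<open>'v\<close> is imposed: as usual, the
  measurable structure is a space \<open>Sec\<close> of sections, maximal with respect to measurability of fibrewise
  inner products and containing a fundamental sequence.
\<close>

locale measurable_field =
  fixes M :: "'a measure" and Fib :: "'a \<Rightarrow> 'v::real_inner set" and Sec :: "('a \<Rightarrow> 'v) set"
  assumes Fib_subspace: "subspace (Fib x)"
    and Fib_complete: "complete (Fib x)"
    and Sec_Fib: "s \<in> Sec \<Longrightarrow> s x \<in> Fib x"
    and Sec_add: "s \<in> Sec \<Longrightarrow> s' \<in> Sec \<Longrightarrow> (\<lambda>x. s x + s' x) \<in> Sec"
    and Sec_scale: "s \<in> Sec \<Longrightarrow> (\<lambda>x. c *\<^sub>R s x) \<in> Sec"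
    and Sec_norm: "s \<in> Sec \<Longrightarrow> (\<lambda>x. norm (s x)) \<in> borel_measurable M"
    and Sec_maximal: "(\<And>x. s x \<in> Fib x) \<Longrightarrow>
        (\<And>s'. s' \<in> Sec \<Longrightarrow> (\<lambda>x. s x \<bullet> s' x) \<in> borel_measurable M) \<Longrightarrow> s \<in> Sec"
    and Sec_fundamental: "\<exists>e :: nat \<Rightarrow> 'a \<Rightarrow> 'v.
        (\<forall>n. e n \<in> Sec) \<and> (\<forall>x. Fib x \<subseteq> closure (span (range (\<lambda>n. e n x))))"

text \<open>
  \<open>U\<close> is the isometry of \<open>'h\<close> onto the direct integral, choosing a representative of each class of
  square-integrable sections; thus \<open>norm (U \<eta> x)\<close> is \<open>\<parallel>\<eta>\<parallel>\<close> in the fibre over \<open>x\<close>.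
\<close>

locale one_forms_fibred = one_forms M D E \<Gamma> tens + measurable_field M Fib Sec
  for M :: "'a::{metric_space, second_countable_topology} measure" and D E \<Gamma>
    and tens :: "('a \<Rightarrow> real) \<Rightarrow> ('a \<Rightarrow> real) \<Rightarrow> 'h::{real_inner, complete_space}"
    and Fib :: "'a \<Rightarrow> 'v::real_inner set" and Sec +
  fixes U :: "'h \<Rightarrow> 'a \<Rightarrow> 'v"
  assumes U_Sec: "U \<eta> \<in> Sec"
    and U_add: "AE x in M. U (\<eta> + \<zeta>) x = U \<eta> x + U \<zeta> x"
    and U_scale: "AE x in M. U (c *\<^sub>R \<eta>) x = c *\<^sub>R U \<eta> x"
    and U_L2: "integrable M (\<lambda>x. (norm (U \<eta> x))\<^sup>2)"
    and U_isometric: "(norm \<eta>)\<^sup>2 = (\<integral>x. (norm (U \<eta> x))\<^sup>2 \<partial>M)"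
    and U_onto: "s \<in> Sec \<Longrightarrow> integrable M (\<lambda>x. (norm (s x))\<^sup>2) \<Longrightarrow> \<exists>\<eta>. AE x in M. U \<eta> x = s x"
    and U_tens: "f\<^sub>1 \<in> core D \<Longrightarrow> f\<^sub>2 \<in> core D \<Longrightarrow> g\<^sub>1 \<in> Bb \<Longrightarrow> g\<^sub>2 \<in> Bb \<Longrightarrow>
        AE x in M. U (tens f\<^sub>1 g\<^sub>1) x \<bullet> U (tens f\<^sub>2 g\<^sub>2) x = g\<^sub>1 x * g\<^sub>2 x * \<Gamma> f\<^sub>1 f\<^sub>2 x"

section \<open>Semigroups\<close>

text \<open>
  For an operator with graph \<open>A\<close>, \<open>e\<^bsup>tA\<^esup>\<close> is the strongly continuous semigroup of bounded operators
  whose infinitesimal generator is exactly \<open>A\<close>; the semigroup is unique, and it exists for every nonpositive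
  self-adjoint \<open>A\<close>. Only times \<open>t \<ge> 0\<close> matter. The two definitions differ only in that elements of
  \<open>L\<^sup>2\<close> are represented by functions.
\<close>

definition c0_semigroup ::
  "('h::real_normed_vector \<Rightarrow> 'h \<Rightarrow> bool) \<Rightarrow> (real \<Rightarrow> 'h \<Rightarrow> 'h) \<Rightarrow> bool" where
  "c0_semigroup A S \<longleftrightarrow>
     (\<forall>t\<ge>0. bounded_linear (S t)) \<and>
     (\<forall>\<eta>. S 0 \<eta> = \<eta>) \<and>
     (\<forall>s\<ge>0. \<forall>t\<ge>0. \<forall>\<eta>. S (s + t) \<eta> = S s (S t \<eta>)) \<and>
     (\<forall>\<eta>. ((\<lambda>t. S t \<eta>) \<longlongrightarrow> \<eta>) (at_right 0)) \<and>
     (\<forall>\<eta> \<zeta>. A \<eta> \<zeta> \<longleftrightarrow> ((\<lambda>t. (S t \<eta> - \<eta>) /\<^sub>R t) \<longlongrightarrow> \<zeta>) (at_right 0))"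

definition l2_c0_semigroup ::
  "'a measure \<Rightarrow> (('a \<Rightarrow> real) \<Rightarrow> ('a \<Rightarrow> real) \<Rightarrow> bool) \<Rightarrow>
   (real \<Rightarrow> ('a \<Rightarrow> real) \<Rightarrow> 'a \<Rightarrow> real) \<Rightarrow> bool" where
  "l2_c0_semigroup M A T \<longleftrightarrow>
     (\<forall>t\<ge>0. \<forall>f\<in>L2 M. T t f \<in> L2 M) \<and>
     (\<forall>t\<ge>0. \<forall>f\<in>L2 M. \<forall>g\<in>L2 M. AE x in M. T t (\<lambda>x. f x + g x) x = T t f x + T t g x) \<and>
     (\<forall>t\<ge>0. \<forall>f\<in>L2 M. \<forall>c. AE x in M. T t (\<lambda>x. c * f x) x = c * T t f x) \<and>
     (\<forall>t\<ge>0. \<exists>K. \<forall>f\<in>L2 M. l2norm M (T t f) \<le> K * l2norm M f) \<and>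
     (\<forall>f\<in>L2 M. AE x in M. T 0 f x = f x) \<and>
     (\<forall>s\<ge>0. \<forall>t\<ge>0. \<forall>f\<in>L2 M. AE x in M. T (s + t) f x = T s (T t f) x) \<and>
     (\<forall>f\<in>L2 M. ((\<lambda>t. l2norm M (\<lambda>x. T t f x - f x)) \<longlongrightarrow> 0) (at_right 0)) \<and>
     (\<forall>f\<in>L2 M. \<forall>w\<in>L2 M. A f w \<longleftrightarrow>
        ((\<lambda>t. l2norm M (\<lambda>x. (T t f x - f x) / t - w x)) \<longlongrightarrow> 0) (at_right 0))"

end

theory Submission
  imports Defs "HOL-Library.Function_Algebras"
begin

text \<open>
  The estimate holds with \<open>C\<^sub>2 = ln C\<^sub>1\<close>. The differential intertwines the two semigroups,
  \<open>\<partial> e\<^bsup>t\<Delta>\<^esup> f = e\<^bsup>t\<Delta>'\<^esup> \<partial>f\<close> for \<open>f \<in> Dom \<E>\<close>, where \<open>\<Delta>' = - \<partial>\<partial>\<^sup>*\<close> (\<open>intertwining\<close>), and the fibre norm of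
  \<open>\<partial>f\<close> is \<open>sqrt (\<Gamma> f)\<close> for all of \<open>Dom \<E>\<close> and not only for the core (\<open>fibre_norm_dform\<close>). So for \<open>t \<le> 1\<close> the
  claim is the domination hypothesis applied to \<open>\<partial>f\<close>. For larger \<open>t\<close> the domination is iterated
  over unit time steps, each of which costs a factor \<open>C\<^sub>1\<close>; this uses that \<open>e\<^bsup>t\<Delta>\<^esup>\<close> preserves
  positivity (\<open>heat_positive\<close>). With \<open>n = \<lfloor>t\<rfloor>\<close> the resulting constant is
  \<open>C\<^sub>1\<^bsup>n+1\<^esup> \<le> C\<^sub>1 exp (t ln C\<^sub>1)\<close>.

  Both analytic facts about the semigroups come from one energy argument. A semigroup is only
  known to be strongly continuous from the right at \<open>0\<close>, with some bound at each time. Uniform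
  boundedness (\<open>gliding_hump\<close>) makes orbits continuous from the left, and then a nonnegative
  function of the orbit is nonincreasing as soon as its square has nonpositive upper right derivative
  (\<open>one_sided_nonincreasing\<close>). For positivity the function is the norm of the negative part of
  \<open>e\<^bsup>t\<Delta>\<^esup> f\<close>; the derivative has the right sign because truncation does not increase the energy
  (\<open>laplacian_neg_part\<close>). For the intertwining it is the norm of \<open>\<partial> e\<^bsup>t\<Delta>\<^esup> f - e\<^bsup>t\<Delta>'\<^esup> \<partial>f\<close>, which
  solves the heat equation for one-forms if \<open>f \<in> Dom \<Delta>\<^sup>2\<close>. That domain is dense in
  \<open>Dom \<E>\<close> (\<open>laplacian_squared_dense_E1\<close>), and the general case follows as \<open>\<partial>\<close> is closed.

  Elements of \<open>L\<^sup>2\<close> are functions and not classes, so the abstract part is carried out in vector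
  spaces with a possibly degenerate inner product, and identities hold up to vectors of norm zero.
\<close>

section \<open>Semi-inner product spaces\<close>

text \<open>Pointwise scalar multiplication makes functions a real vector space.\<close>

instantiation "fun" :: (type, real_vector) real_vector
begin

definition scaleR_fun :: "real \<Rightarrow> ('a \<Rightarrow> 'b) \<Rightarrow> 'a \<Rightarrow> 'b" where
  "scaleR_fun c f = (\<lambda>x. c *\<^sub>R f x)"

instance
  by standard (simp_all add: scaleR_fun_def fun_eq_iff scaleR_add_right scaleR_add_left)

end

text \<open>
  A possibly degenerate inner product \<open>ip\<close> on a subspace \<open>V\<close>. Outside \<open>V\<close> nothing is assumed
  about \<open>ip\<close>.
\<close>

locale semi_inner =
  fixes V :: "'b::real_vector set" and ip :: "'b \<Rightarrow> 'b \<Rightarrow> real"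
  assumes V_subspace: "subspace V"
    and ip_sym: "x \<in> V \<Longrightarrow> y \<in> V \<Longrightarrow> ip x y = ip y x"
    and ip_add_left: "x \<in> V \<Longrightarrow> y \<in> V \<Longrightarrow> z \<in> V \<Longrightarrow> ip (x + y) z = ip x z + ip y z"
    and ip_scale_left: "x \<in> V \<Longrightarrow> z \<in> V \<Longrightarrow> ip (c *\<^sub>R x) z = c * ip x z"
    and ip_nonneg: "x \<in> V \<Longrightarrow> 0 \<le> ip x x"
begin

text \<open>The seminorm of \<open>ip\<close>.\<close>

definition nrm :: "'b \<Rightarrow> real" where
  "nrm x = sqrt (ip x x)"

lemma V_closed [simp, intro]:
  "0 \<in> V" "x \<in> V \<Longrightarrow> y \<in> V \<Longrightarrow> x + y \<in> V" "x \<in> V \<Longrightarrow> y \<in> V \<Longrightarrow> x - y \<in> V"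
  "x \<in> V \<Longrightarrow> c *\<^sub>R x \<in> V" "x \<in> V \<Longrightarrow> - x \<in> V"
  using V_subspace by (auto intro: subspace_0 subspace_add subspace_diff subspace_scale subspace_neg)

lemma ip_minus_left: "x \<in> V \<Longrightarrow> z \<in> V \<Longrightarrow> ip (- x) z = - ip x z"
  using ip_scale_left[of x z "-1"] by simp

lemma ip_diff_left: "x \<in> V \<Longrightarrow> y \<in> V \<Longrightarrow> z \<in> V \<Longrightarrow> ip (x - y) z = ip x z - ip y z"
  using ip_add_left[of x "- y" z] by (simp add: ip_minus_left)

lemma ip_add_right: "x \<in> V \<Longrightarrow> y \<in> V \<Longrightarrow> z \<in> V \<Longrightarrow> ip z (x + y) = ip z x + ip z y"
  by (simp add: ip_sym[of z] ip_add_left)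

lemma ip_scale_right: "x \<in> V \<Longrightarrow> z \<in> V \<Longrightarrow> ip z (c *\<^sub>R x) = c * ip z x"
  by (simp add: ip_sym[of z] ip_scale_left)

lemma ip_minus_right: "x \<in> V \<Longrightarrow> z \<in> V \<Longrightarrow> ip z (- x) = - ip z x"
  by (simp add: ip_sym[of z] ip_minus_left)

lemma ip_diff_right: "x \<in> V \<Longrightarrow> y \<in> V \<Longrightarrow> z \<in> V \<Longrightarrow> ip z (x - y) = ip z x - ip z y"
  by (simp add: ip_sym[of z] ip_diff_left)

lemmas ip_simps = ip_add_left ip_add_right ip_diff_left ip_diff_right ip_scale_left ip_scale_right
  ip_minus_left ip_minus_right

lemma nrm_sq: "x \<in> V \<Longrightarrow> (nrm x)\<^sup>2 = ip x x"
  by (simp add: nrm_def ip_nonneg)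

lemma nrm_nonneg [simp]: "x \<in> V \<Longrightarrow> 0 \<le> nrm x"
  by (simp add: nrm_def ip_nonneg)

lemma nrm_zero [simp]: "nrm 0 = 0"
  using ip_scale_left[of 0 0 0] by (simp add: nrm_def)

lemma nrm_scale: "x \<in> V \<Longrightarrow> nrm (c *\<^sub>R x) = \<bar>c\<bar> * nrm x"
  by (simp add: nrm_def ip_simps real_sqrt_mult[symmetric] mult.assoc[symmetric])
     (simp add: real_sqrt_mult)

lemma nrm_minus [simp]: "x \<in> V \<Longrightarrow> nrm (- x) = nrm x"
  using nrm_scale[of x "-1"] by simp

lemma nrm_minus_commute: "x \<in> V \<Longrightarrow> y \<in> V \<Longrightarrow> nrm (x - y) = nrm (y - x)"
  using nrm_minus[of "x - y"] by simp

lemma Cauchy_Schwarz: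
  assumes "x \<in> V" "y \<in> V"
  shows "\<bar>ip x y\<bar> \<le> nrm x * nrm y"
proof -
  have q: "0 \<le> ip x x + 2 * t * ip x y + t\<^sup>2 * ip y y" for t
    using ip_nonneg[of "x + t *\<^sub>R y"] assms
    by (simp add: ip_simps ip_sym[of y x] power2_eq_square algebra_simps)
  have "(ip x y)\<^sup>2 \<le> ip x x * ip y y"
  proof (cases "ip y y = 0")
    case True
    have "ip x y = 0"
    proof (rule ccontr)
      assume n: "ip x y \<noteq> 0"
      have "0 \<le> ip x x + 2 * (- (ip x x + 1) / (2 * ip x y)) * ip x y"
        using q[of "- (ip x x + 1) / (2 * ip x y)"] True by simp
      also have "\<dots> = -1" using n by (simp add: field_simps)
      finally show False by simp
    qed
    then show ?thesis using True by simp
  next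
    case False
    then have p: "ip y y > 0" using ip_nonneg[OF assms(2)] by simp
    have "0 \<le> ip x x + 2 * (- ip x y / ip y y) * ip x y + (- ip x y / ip y y)\<^sup>2 * ip y y"
      by (rule q)
    also have "\<dots> = ip x x - (ip x y)\<^sup>2 / ip y y"
      using p by (simp add: power2_eq_square field_simps)
    finally show ?thesis using p by (simp add: field_simps)
  qed
  then have "sqrt ((ip x y)\<^sup>2) \<le> sqrt (ip x x * ip y y)"
    by (rule real_sqrt_le_mono)
  then show ?thesis by (simp add: nrm_def real_sqrt_mult)
qed

lemma nrm_triangle:
  assumes "x \<in> V" "y \<in> V"
  shows "nrm (x + y) \<le> nrm x + nrm y"
proof (rule power2_le_imp_le)
  have "(nrm (x + y))\<^sup>2 = (nrm x)\<^sup>2 + 2 * ip x y + (nrm y)\<^sup>2"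
    using assms by (simp add: nrm_sq ip_simps ip_sym[of y x])
  also have "\<dots> \<le> (nrm x + nrm y)\<^sup>2"
    using Cauchy_Schwarz[OF assms] by (simp add: power2_sum)
  finally show "(nrm (x + y))\<^sup>2 \<le> (nrm x + nrm y)\<^sup>2" .
qed (use assms in simp)

lemma nrm_triangle_diff: "x \<in> V \<Longrightarrow> y \<in> V \<Longrightarrow> nrm (x - y) \<le> nrm x + nrm y"
  using nrm_triangle[of x "- y"] by simp

lemma nrm_triangle_sub: "x \<in> V \<Longrightarrow> y \<in> V \<Longrightarrow> nrm x \<le> nrm y + nrm (x - y)"
  using nrm_triangle[of y "x - y"] by simp

lemma nrm_triangle_mid: "x \<in> V \<Longrightarrow> y \<in> V \<Longrightarrow> z \<in> V \<Longrightarrow> nrm (x - z) \<le> nrm (x - y) + nrm (y - z)"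
  using nrm_triangle[of "x - y" "y - z"] by simp

lemma nrm_eqI: "x \<in> V \<Longrightarrow> y \<in> V \<Longrightarrow> nrm (x - y) = 0 \<Longrightarrow> nrm x = nrm y"
  using nrm_triangle_sub[of x y] nrm_triangle_sub[of y x] nrm_minus_commute[of x y] by linarith

lemma nrm_null_trans:
  "x \<in> V \<Longrightarrow> y \<in> V \<Longrightarrow> z \<in> V \<Longrightarrow> nrm (x - y) = 0 \<Longrightarrow> nrm (y - z) = 0 \<Longrightarrow> nrm (x - z) = 0"
  using nrm_triangle_mid[of x y z] nrm_nonneg[of "x - z"] by fastforce

lemma parallelogram:
  "x \<in> V \<Longrightarrow> y \<in> V \<Longrightarrow> (nrm (x + y))\<^sup>2 + (nrm (x - y))\<^sup>2 = 2 * (nrm x)\<^sup>2 + 2 * (nrm y)\<^sup>2"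
  by (simp add: nrm_sq ip_simps)

lemma ip_null: "x \<in> V \<Longrightarrow> y \<in> V \<Longrightarrow> nrm x = 0 \<Longrightarrow> ip x y = 0"
  using Cauchy_Schwarz[of x y] by simp

lemma geometric_increments:
  assumes u: "\<And>n. u n \<in> V" and q: "0 < q" "q < 1"
    and inc: "\<And>n. nrm (u (Suc n) - u n) \<le> q ^ n" and "n \<le> m"
  shows "nrm (u m - u n) \<le> q ^ n / (1 - q)"
proof -
  have "nrm (u m - u n) \<le> (q ^ n - q ^ m) / (1 - q)"
    using \<open>n \<le> m\<close>
  proof (induction m rule: dec_induct)
    case (step m)
    have "nrm (u (Suc m) - u n) \<le> q ^ m + (q ^ n - q ^ m) / (1 - q)"
      using nrm_triangle_mid[of "u (Suc m)" "u m" "u n"] u inc[of m] step.IH by fastforce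
    also have "\<dots> = (q ^ n - q ^ Suc m) / (1 - q)"
      using q by (simp add: field_simps)
    finally show ?case .
  qed simp
  also have "\<dots> \<le> q ^ n / (1 - q)"
    using q by (intro divide_right_mono) auto
  finally show ?thesis .
qed

lemma tendsto_nrm_unique:
  assumes "\<And>n. u n \<in> V" "v \<in> V" "w \<in> V"
    and "(\<lambda>n. nrm (u n - v)) \<longlonglongrightarrow> 0" "(\<lambda>n. nrm (u n - w)) \<longlonglongrightarrow> 0"
  shows "nrm (v - w) = 0"
proof (rule antisym)
  have "(\<lambda>n. nrm (u n - v) + nrm (u n - w)) \<longlonglongrightarrow> 0"
    using tendsto_add[OF assms(4,5)] by simp
  moreover have "nrm (v - w) \<le> nrm (u n - v) + nrm (u n - w)" for n
    using nrm_triangle_mid[of v "u n" w] nrm_minus_commute[of v "u n"] assms(1-3) by simp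
  ultimately show "nrm (v - w) \<le> 0" by (intro LIMSEQ_le_const) auto
qed (use assms in simp)

lemma tendsto_ip:
  assumes "\<And>n. u n \<in> V" "v \<in> V" "w \<in> V" "(\<lambda>n. nrm (u n - v)) \<longlonglongrightarrow> 0"
  shows "(\<lambda>n. ip (u n) w) \<longlonglongrightarrow> ip v w"
proof -
  have "(\<lambda>n. nrm (u n - v) * nrm w) \<longlonglongrightarrow> 0"
    using tendsto_mult_right[OF assms(4), of "nrm w"] by simp
  then have "(\<lambda>n. ip (u n) w - ip v w) \<longlonglongrightarrow> 0"
  proof (rule Lim_null_comparison[rotated], intro always_eventually allI)
    fix n show "norm (ip (u n) w - ip v w) \<le> nrm (u n - v) * nrm w"
      using Cauchy_Schwarz[of "u n - v" w] assms by (simp add: ip_simps)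
  qed
  then show ?thesis by (rule LIM_zero_cancel)
qed

text \<open>
  The infinitesimal form of the energy method: a curve leaving \<open>u\<close> with velocity \<open>w\<close> does not
  increase the distance to \<open>u + p\<close> to first order when the velocity points towards \<open>p\<close>.
\<close>

lemma distance_first_order:
  assumes V: "\<And>h. h > 0 \<Longrightarrow> v h \<in> V" "u \<in> V" "w \<in> V" "p \<in> V"
    and lim: "((\<lambda>h. nrm ((v h - u) /\<^sub>R h - w)) \<longlongrightarrow> 0) (at_right 0)"
    and pos: "0 \<le> ip w p" and "\<epsilon> > 0"
  shows "eventually (\<lambda>h. (nrm ((v h - u) - p))\<^sup>2 \<le> (nrm p)\<^sup>2 + \<epsilon> * h) (at_right (0::real))"
proof -
  let ?e = "\<lambda>h. nrm ((v h - u) /\<^sub>R h - w)"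
  have "((\<lambda>h. h * (?e h + nrm w)\<^sup>2 + 2 * ?e h * nrm p) \<longlongrightarrow> 0 * (0 + nrm w)\<^sup>2 + 2 * 0 * nrm p)
      (at_right 0)"
    by (intro tendsto_intros lim)
  then have "eventually (\<lambda>h. h * (?e h + nrm w)\<^sup>2 + 2 * ?e h * nrm p < \<epsilon>) (at_right 0)"
    using \<open>\<epsilon> > 0\<close> by (auto intro: order_tendstoD(2))
  moreover have "eventually (\<lambda>h::real. h > 0) (at_right 0)"
    by (rule eventually_at_right_less)
  ultimately show ?thesis
  proof eventually_elim
    case (elim h)
    define d where "d = (v h - u) /\<^sub>R h"
    have dV: "d \<in> V" and vd: "v h - u = h *\<^sub>R d"
      using V elim by (auto simp: d_def)
    have dw: "nrm d \<le> ?e h + nrm w"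
      using nrm_triangle_sub[of d w] dV V by (simp add: d_def)
    have "- ip d p \<le> - ip (d - w) p"
      using pos V dV by (simp add: ip_simps)
    also have "\<dots> \<le> ?e h * nrm p"
      using Cauchy_Schwarz[of "d - w" p] V dV by (simp add: d_def)
    finally have ipd: "- ip d p \<le> ?e h * nrm p" .
    have "(nrm ((v h - u) - p))\<^sup>2 = h\<^sup>2 * (nrm d)\<^sup>2 + 2 * h * (- ip d p) + (nrm p)\<^sup>2"
      unfolding vd using V dV
      by (simp add: nrm_sq ip_simps ip_sym[of p d]) (simp add: power2_eq_square algebra_simps)
    also have "\<dots> \<le> h\<^sup>2 * (?e h + nrm w)\<^sup>2 + 2 * h * (?e h * nrm p) + (nrm p)\<^sup>2"
      using dw ipd elim(2) dV V(4)
      by (intro add_mono mult_left_mono power_mono) auto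
    also have "\<dots> = h * (h * (?e h + nrm w)\<^sup>2 + 2 * ?e h * nrm p) + (nrm p)\<^sup>2"
      by (simp add: power2_eq_square algebra_simps)
    also have "\<dots> \<le> h * \<epsilon> + (nrm p)\<^sup>2"
      using elim by (intro add_right_mono mult_left_mono) auto
    finally show ?case by (simp add: mult.commute)
  qed
qed

end

text \<open>
  Completeness is required only for sequences with geometrically decreasing increments. Limits
  are unique up to vectors of norm zero.
\<close>

locale semi_hilbert = semi_inner +
  assumes complete: "(\<And>n. u n \<in> V) \<Longrightarrow> (\<And>n. nrm (u (Suc n) - u n) \<le> (1/2) ^ n) \<Longrightarrow>
      \<exists>v\<in>V. (\<lambda>n. nrm (u n - v)) \<longlonglongrightarrow> 0"
begin

text \<open>
  A bounded linear functional on a subspace is represented by a vector in the closure of the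
  subspace: the minimizer of \<open>\<parallel>w\<parallel>\<^sup>2 - 2 l(w)\<close>.
\<close>

lemma representation:
  assumes W: "subspace W" "W \<subseteq> V"
    and l_add: "\<And>x y. x \<in> W \<Longrightarrow> y \<in> W \<Longrightarrow> l (x + y) = l x + l y"
    and l_scale: "\<And>c x. x \<in> W \<Longrightarrow> l (c *\<^sub>R x) = c * l x"
    and l_bdd: "\<And>x. x \<in> W \<Longrightarrow> \<bar>l x\<bar> \<le> K * nrm x"
  obtains u p where "\<And>n. u n \<in> W" "p \<in> V" "(\<lambda>n. nrm (u n - p)) \<longlonglongrightarrow> 0"
    "\<And>w. w \<in> W \<Longrightarrow> ip p w = l w"
proof -
  define J where "J = (\<lambda>w. (nrm w)\<^sup>2 - 2 * l w)"
  have WV: "w \<in> W \<Longrightarrow> w \<in> V" for w using W by auto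
  have lower: "- K\<^sup>2 \<le> J w" if "w \<in> W" for w
  proof -
    have "0 \<le> (nrm w - K)\<^sup>2" by simp
    then have "- K\<^sup>2 \<le> (nrm w)\<^sup>2 - 2 * (K * nrm w)" by (simp add: power2_diff mult.commute)
    then show ?thesis using l_bdd[OF that] unfolding J_def by linarith
  qed
  define m where "m = Inf (J ` W)"
  have bdd: "bdd_below (J ` W)" using lower by (intro bdd_belowI2) auto
  have ne: "J ` W \<noteq> {}" using subspace_0[OF W(1)] by auto
  have m_le: "m \<le> J w" if "w \<in> W" for w
    unfolding m_def using that bdd by (intro cInf_lower) auto
  \<comment> \<open>This rate makes the minimizing sequence have increments of norm at most \<open>2\<^sup>-\<^sup>n\<close>.\<close>
  have "\<exists>w\<in>W. J w < m + (1/16) * (1/4) ^ n" for n :: nat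
  proof -
    have "Inf (J ` W) < m + (1/16) * (1/4) ^ n" by (simp add: m_def)
    from cInf_lessD[OF ne this] show ?thesis by auto
  qed
  then obtain u where uW: "\<And>n. u n \<in> W" and uJ: "\<And>n. J (u n) < m + (1/16) * (1/4) ^ n"
    by metis
  have uV: "u n \<in> V" for n using uW WV by auto
  have "nrm (u (Suc n) - u n) \<le> (1/2) ^ n" for n
  proof (rule power2_le_imp_le)
    let ?x = "u (Suc n)" and ?y = "u n"
    define z where "z = (1/2) *\<^sub>R (?x + ?y)"
    have zW: "z \<in> W" using uW W(1) by (auto simp: z_def intro: subspace_scale subspace_add)
    have "(nrm z)\<^sup>2 = (1/4) * (nrm (?x + ?y))\<^sup>2"
      using uV by (simp add: z_def nrm_scale power_mult_distrib power2_eq_square)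
    moreover have "l z = (1/2) * (l ?x + l ?y)"
      unfolding z_def using uW W(1) by (simp add: l_scale l_add subspace_add)
    ultimately have "J ?x + J ?y = 2 * J z + (1/2) * (nrm (?x - ?y))\<^sup>2"
      using parallelogram[OF uV[of "Suc n"] uV[of n]] by (simp add: J_def)
    moreover have "J ?x + J ?y \<le> 2 * m + (1/8) * (1/4) ^ n"
    proof -
      have "0 \<le> (1/4 :: real) ^ n" by simp
      then show ?thesis using uJ[of "Suc n"] uJ[of n] unfolding power_Suc by linarith
    qed
    ultimately have "(nrm (?x - ?y))\<^sup>2 \<le> (1/4) * (1/4) ^ n"
      using m_le[OF zW] by linarith
    also have "\<dots> \<le> (1/4) ^ n" by simp
    also have "\<dots> = ((1/2) ^ n)\<^sup>2" by (simp add: power_divide power2_eq_square flip: power_mult_distrib)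
    finally show "(nrm (?x - ?y))\<^sup>2 \<le> ((1/2) ^ n)\<^sup>2" .
  qed simp
  with complete[of u] uV obtain p where p: "p \<in> V" "(\<lambda>n. nrm (u n - p)) \<longlonglongrightarrow> 0" by blast
  have "ip p w = l w" if w: "w \<in> W" for w
  proof -
    define b where "b = ip p w - l w"
    \<comment> \<open>The first variation of \<open>J\<close> at its minimum in the direction of \<open>w\<close>.\<close>
    have key: "- (2 * t * b) \<le> t\<^sup>2 * ip w w" for t
    proof -
      have bnd: "- (2 * t * (ip (u n) w - l w)) \<le> t\<^sup>2 * ip w w + (1/16) * (1/4) ^ n" for n
      proof -
        have "u n + t *\<^sub>R w \<in> W" using uW w W(1) by (auto intro: subspace_add subspace_scale)
        from m_le[OF this] have "m \<le> J (u n) + 2 * t * (ip (u n) w - l w) + t\<^sup>2 * ip w w"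
          using uV[of n] WV[OF w] uW[of n] w W(1)
          by (simp add: J_def nrm_sq ip_simps ip_sym[of w "u n"] l_add l_scale subspace_scale)
             (simp add: power2_eq_square algebra_simps)
        then show ?thesis using uJ[of n] by linarith
      qed
      have "(\<lambda>n. - (2 * t * (ip (u n) w - l w))) \<longlonglongrightarrow> - (2 * t * b)"
        unfolding b_def by (intro tendsto_intros tendsto_ip uV p WV w)
      moreover have "(\<lambda>n. t\<^sup>2 * ip w w + (1/16) * (1/4) ^ n) \<longlonglongrightarrow> t\<^sup>2 * ip w w + (1/16) * 0"
        by (intro tendsto_intros LIMSEQ_power_zero) auto
      ultimately show ?thesis
        using bnd LIMSEQ_le by fastforce
    qed
    have "b = 0"
    proof (rule ccontr)
      assume b: "b \<noteq> 0"
      define a where "a = ip w w + 1"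
      have a: "a > 0" "ip w w \<le> a" using ip_nonneg[OF WV[OF w]] by (auto simp: a_def)
      have "2 * b\<^sup>2 / a \<le> (b / a)\<^sup>2 * ip w w"
        using key[of "- b / a"] by (simp add: power2_eq_square)
      also have "\<dots> \<le> (b / a)\<^sup>2 * a" using a by (intro mult_left_mono) auto
      also have "\<dots> = b\<^sup>2 / a" using a by (simp add: power2_eq_square)
      finally show False using a b by (simp add: field_simps)
    qed
    then show ?thesis by (simp add: b_def)
  qed
  with that[of u p] uW p show ?thesis by blast
qed

text \<open>
  Density of a subspace with trivial orthogonal complement: the vector \<open>p\<close> that represents
  \<open>ip x\<close> on \<open>W\<close> is the orthogonal projection of \<open>x\<close> to the closure of \<open>W\<close>.
\<close>

lemma dense_if_orthogonal_trivial:
  assumes W: "subspace W" "W \<subseteq> V" and x: "x \<in> V"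
    and orth: "\<And>y. y \<in> V \<Longrightarrow> (\<And>w. w \<in> W \<Longrightarrow> ip y w = 0) \<Longrightarrow> nrm y = 0"
  obtains u where "\<And>n. u n \<in> W" "(\<lambda>n. nrm (u n - x)) \<longlonglongrightarrow> 0"
proof -
  have WV: "w \<in> W \<Longrightarrow> w \<in> V" for w using W by auto
  have "\<bar>ip x w\<bar> \<le> nrm x * nrm w" if "w \<in> W" for w
    using that by (intro Cauchy_Schwarz x) (rule WV)
  then obtain u p where u: "\<And>n. u n \<in> W" and p: "p \<in> V" "(\<lambda>n. nrm (u n - p)) \<longlonglongrightarrow> 0"
    and ipp: "\<And>w. w \<in> W \<Longrightarrow> ip p w = ip x w"
    using representation[of W "ip x" "nrm x"] W x WV by (auto simp: ip_simps)
  have "nrm (p - x) = 0"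
    using p x WV ipp by (intro orth) (auto simp: ip_simps)
  then have "nrm (u n - x) = nrm (u n - p)" for n
    using nrm_eqI[of "u n - x" "u n - p"] u WV p x by simp
  then show thesis using that[of u, OF u] p by simp
qed

end

section \<open>Strongly continuous semigroups\<close>

context semi_inner
begin

text \<open>Bounded linear operators, where linearity is required only up to vectors of norm zero.\<close>

definition bdd_op :: "('b \<Rightarrow> 'b) \<Rightarrow> bool" where
  "bdd_op A \<longleftrightarrow> (\<forall>x\<in>V. A x \<in> V) \<and> (\<forall>x\<in>V. \<forall>y\<in>V. nrm (A (x + y) - (A x + A y)) = 0) \<and>
     (\<forall>x\<in>V. \<forall>c. nrm (A (c *\<^sub>R x) - c *\<^sub>R A x) = 0) \<and> (\<exists>K. \<forall>x\<in>V. nrm (A x) \<le> K * nrm x)"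

lemma bdd_op_V [intro]: "bdd_op A \<Longrightarrow> x \<in> V \<Longrightarrow> A x \<in> V"
  by (simp add: bdd_op_def)

lemma bdd_op_bound:
  assumes "bdd_op A"
  obtains K where "0 \<le> K" "\<And>x. x \<in> V \<Longrightarrow> nrm (A x) \<le> K * nrm x"
proof -
  obtain K where K: "\<forall>x\<in>V. nrm (A x) \<le> K * nrm x" using assms unfolding bdd_op_def by blast
  have "nrm (A x) \<le> max K 0 * nrm x" if "x \<in> V" for x
  proof -
    have "K * nrm x \<le> max K 0 * nrm x" using that by (intro mult_right_mono) auto
    then show ?thesis using K that by force
  qed
  then show thesis using that[of "max K 0"] by auto
qed

lemma bdd_op_nrm_scale:
  assumes A: "bdd_op A" and [simp]: "x \<in> V"
  shows "nrm (A (c *\<^sub>R x)) = \<bar>c\<bar> * nrm (A x)"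
proof -
  have [simp]: "A x \<in> V" "A (c *\<^sub>R x) \<in> V" using A by auto
  have "nrm (A (c *\<^sub>R x)) = nrm (c *\<^sub>R A x)" using A by (intro nrm_eqI) (auto simp: bdd_op_def)
  then show ?thesis by (simp add: nrm_scale)
qed

lemma bdd_op_diff:
  assumes A: "bdd_op A" and [simp]: "x \<in> V" "y \<in> V"
  shows "nrm (A (x - y) - (A x - A y)) = 0"
proof -
  have [simp]: "A x \<in> V" "A y \<in> V" "A (x - y) \<in> V" using A by auto
  have "nrm (A (a + b) - (A a + A b)) = 0" if "a \<in> V" "b \<in> V" for a b
    using A that by (simp add: bdd_op_def)
  from this[of "x - y" y] have "nrm (A x - (A (x - y) + A y)) = 0" by simp
  then show ?thesis
    using nrm_minus_commute[of "A x - A y" "A (x - y)"] by (simp add: algebra_simps)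
qed

lemma bdd_op_nrm_diff:
  assumes A: "bdd_op A" and [simp]: "x \<in> V" "y \<in> V"
  shows "nrm (A x - A y) = nrm (A (x - y))"
proof -
  have [simp]: "A x \<in> V" "A y \<in> V" "A (x - y) \<in> V" using A by auto
  show ?thesis using nrm_eqI[OF _ _ bdd_op_diff[OF A], of x y] by simp
qed

lemma operator_norm:
  assumes A: "bdd_op A"
  obtains m where "\<And>x. x \<in> V \<Longrightarrow> nrm (A x) \<le> m * nrm x"
    "\<And>c. c < m \<Longrightarrow> \<exists>x\<in>V. nrm x \<le> 1 \<and> c < nrm (A x)"
proof -
  define N where "N = (\<lambda>x. nrm (A x)) ` {x\<in>V. nrm x \<le> 1}"
  obtain K where K: "0 \<le> K" "\<And>x. x \<in> V \<Longrightarrow> nrm (A x) \<le> K * nrm x"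
    using bdd_op_bound[OF A] by blast
  have bdd: "bdd_above N" unfolding N_def
  proof (intro bdd_aboveI2)
    fix x assume "x \<in> {x\<in>V. nrm x \<le> 1}"
    then show "nrm (A x) \<le> K" using K(2)[of x] K(1) mult_left_le[of "nrm x" K] by simp
  qed
  have ne: "N \<noteq> {}" unfolding N_def by auto
  show thesis
  proof (rule that[of "Sup N"])
    fix x assume x: "x \<in> V"
    show "nrm (A x) \<le> Sup N * nrm x"
    proof (cases "nrm x = 0")
      case True
      then show ?thesis using K(2)[OF x] by simp
    next
      case False
      then have p: "nrm x > 0" using nrm_nonneg[OF x] by linarith
      have "nrm (A ((1 / nrm x) *\<^sub>R x)) \<in> N"
        unfolding N_def using x p by (intro imageI) (auto simp: nrm_scale)
      then have "nrm (A ((1 / nrm x) *\<^sub>R x)) \<le> Sup N" using bdd by (rule cSup_upper)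
      then have "nrm (A x) / nrm x \<le> Sup N"
        using p by (simp add: bdd_op_nrm_scale[OF A x])
      then show ?thesis using p by (simp add: field_simps)
    qed
  next
    fix c assume "c < Sup N"
    from less_cSupD[OF ne this] show "\<exists>x\<in>V. nrm x \<le> 1 \<and> c < nrm (A x)"
      by (auto simp: N_def)
  qed
qed

end

context semi_hilbert
begin

text \<open>
  Uniform boundedness by a gliding hump: at stage \<open>n\<close> a vector of norm at most \<open>4\<^sup>-\<^sup>n\<close> on which
  \<open>A n\<close> is large is added or subtracted, whichever makes the image larger; the later stages are
  too small to destroy this.
\<close>

lemma gliding_hump:
  assumes A: "\<And>n::nat. bdd_op (A n)"
    and large: "\<And>n. \<exists>x\<in>V. 3 * real n * 4 ^ n * nrm x < nrm (A n x)"
  obtains z where "z \<in> V" "\<And>n. real n \<le> nrm (A n z)"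
proof -
  have "\<exists>m. (\<forall>x\<in>V. nrm (A n x) \<le> m * nrm x) \<and> (\<forall>c<m. \<exists>x\<in>V. nrm x \<le> 1 \<and> c < nrm (A n x))" for n
    using operator_norm[OF A[of n]] by metis
  then obtain m where m_bd: "\<And>n x. x \<in> V \<Longrightarrow> nrm (A n x) \<le> m n * nrm x"
    and m_sup: "\<And>n c. c < m n \<Longrightarrow> \<exists>x\<in>V. nrm x \<le> 1 \<and> c < nrm (A n x)"
    by metis
  have m_large: "3 * real n * 4 ^ n < m n" for n
  proof -
    obtain x where x: "x \<in> V" "3 * real n * 4 ^ n * nrm x < nrm (A n x)" using large by blast
    then have "3 * real n * 4 ^ n * nrm x < m n * nrm x" using m_bd[OF x(1), of n] by linarith
    then show ?thesis using x(1) by (simp add: mult_less_cancel_right)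
  qed
  have m_pos: "0 < m n" for n
    using m_large[of n] by (rule le_less_trans[rotated]) simp
  have "\<exists>x\<in>V. nrm x \<le> 1 \<and> (2/3) * m n < nrm (A n x)" for n
    using m_pos[of n] by (intro m_sup) simp
  then obtain x where x: "\<And>n. x n \<in> V" "\<And>n. nrm (x n) \<le> 1" "\<And>n. (2/3) * m n < nrm (A n (x n))"
    by metis
  define y where "y = (\<lambda>n. (1/4) ^ n *\<^sub>R x n)"
  have y: "y n \<in> V" for n using x by (auto simp: y_def)
  have yn: "nrm (y n) \<le> (1/4) ^ n" for n
    using x[of n] by (simp add: y_def nrm_scale mult_left_le)
  have Ay: "(2/3) * m n * (1/4) ^ n \<le> nrm (A n (y n))" for n
    unfolding y_def using bdd_op_nrm_scale[OF A x(1)] x(3)[of n]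
    by (simp add: mult.commute divide_right_mono)
  \<comment> \<open>Since \<open>A n (z + y) - A n (z - y) = 2 A n y\<close>, one of the two signs keeps the image as large as \<open>A n y\<close>.\<close>
  define step where "step = (\<lambda>n z. if nrm (A n (z - y n)) \<le> nrm (A n (z + y n)) then z + y n else z - y n)"
  define u where "u = rec_nat 0 step"
  have u_Suc: "u (Suc n) = step n (u n)" for n by (simp add: u_def)
  have uV: "u n \<in> V" for n
    by (induction n) (auto simp: u_Suc step_def y, auto simp: u_def)
  have inc: "nrm (u (Suc n) - u n) \<le> (1/4) ^ n" for n
    using yn[of n] y[of n] uV[of n] by (simp add: u_Suc step_def)
  have big: "nrm (A n (y n)) \<le> nrm (A n (u (Suc n)))" for n
  proof -
    have V: "y n \<in> V" "u n \<in> V" "u n + y n \<in> V" "u n - y n \<in> V" using y uV by auto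
    have "(u n + y n) - (u n - y n) = 2 *\<^sub>R y n" by (simp add: scaleR_2)
    then have "2 * nrm (A n (y n)) = nrm (A n (u n + y n) - A n (u n - y n))"
      using bdd_op_nrm_scale[OF A V(1), of n 2] bdd_op_nrm_diff[OF A V(3,4), of n] by simp
    also have "\<dots> \<le> nrm (A n (u n + y n)) + nrm (A n (u n - y n))"
      using bdd_op_V[OF A V(3)] bdd_op_V[OF A V(4)] by (rule nrm_triangle_diff)
    finally show ?thesis by (auto simp: u_Suc step_def)
  qed
  have "nrm (u (Suc n) - u n) \<le> (1/2) ^ n" for n
    using inc[of n] power_mono[of "1/4" "1/2::real" n] by simp
  then obtain z where z: "z \<in> V" "(\<lambda>n. nrm (u n - z)) \<longlonglongrightarrow> 0"
    using complete[of u] uV by blast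
  have tail: "nrm (z - u (Suc n)) \<le> (1/3) * (1/4) ^ n" for n
  proof -
    have "nrm (z - u (Suc n)) \<le> nrm (u k - z) + (1/3) * (1/4) ^ n" if "k \<ge> Suc n" for k
      using geometric_increments[of u "1/4" "Suc n" k, OF uV _ _ inc that]
        nrm_triangle_mid[of z "u k" "u (Suc n)"] nrm_minus_commute[of z "u k"] z uV by simp
    moreover have "(\<lambda>k. nrm (u k - z) + (1/3) * (1/4) ^ n) \<longlonglongrightarrow> 0 + (1/3) * (1/4) ^ n"
      by (intro tendsto_intros z)
    ultimately show ?thesis by (intro LIMSEQ_le_const[of _ "(1/3) * (1/4) ^ n"]) auto
  qed
  have "real n \<le> nrm (A n z)" for n
  proof -
    have V: "A n (u (Suc n)) \<in> V" "A n z \<in> V" using A uV z by auto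
    have "nrm (A n (u (Suc n))) \<le> nrm (A n z) + nrm (A n (u (Suc n)) - A n z)"
      by (rule nrm_triangle_sub[OF V])
    also have "nrm (A n (u (Suc n)) - A n z) = nrm (A n (u (Suc n) - z))"
      by (rule bdd_op_nrm_diff[OF A uV z(1)])
    also have "\<dots> \<le> m n * nrm (u (Suc n) - z)" using uV z by (intro m_bd) auto
    also have "\<dots> \<le> m n * ((1/3) * (1/4) ^ n)"
      using tail[of n] m_pos[of n] nrm_minus_commute[OF uV z(1)] by (intro mult_left_mono) auto
    finally have "(1/3) * m n * (1/4) ^ n \<le> nrm (A n z)" using big[of n] Ay[of n] by simp
    moreover have "real n \<le> (1/3) * m n * (1/4) ^ n"
      using m_large[of n] by (simp add: power_divide field_simps)
    ultimately show ?thesis by linarith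
  qed
  with z that show thesis by blast
qed

end

text \<open>Strongly continuous semigroups; all identities hold up to vectors of norm zero.\<close>

locale c0_sg = semi_hilbert V ip for V :: "'b::real_vector set" and ip +
  fixes T :: "real \<Rightarrow> 'b \<Rightarrow> 'b"
  assumes T_op: "0 \<le> t \<Longrightarrow> bdd_op (T t)"
    and T_0: "x \<in> V \<Longrightarrow> nrm (T 0 x - x) = 0"
    and T_add: "0 \<le> s \<Longrightarrow> 0 \<le> t \<Longrightarrow> x \<in> V \<Longrightarrow> nrm (T (s + t) x - T s (T t x)) = 0"
    and T_cont: "x \<in> V \<Longrightarrow> ((\<lambda>t. nrm (T t x - x)) \<longlongrightarrow> 0) (at_right 0)"
begin

lemma T_V [simp, intro]: "0 \<le> t \<Longrightarrow> x \<in> V \<Longrightarrow> T t x \<in> V"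
  using T_op by blast

text \<open>The graph of the infinitesimal generator.\<close>

definition gen :: "'b \<Rightarrow> 'b \<Rightarrow> bool" where
  "gen x w \<longleftrightarrow> x \<in> V \<and> w \<in> V \<and> ((\<lambda>t. nrm ((T t x - x) /\<^sub>R t - w)) \<longlongrightarrow> 0) (at_right 0)"

lemma locally_bounded:
  obtains \<delta> K where "\<delta> > 0" "K \<ge> 0" "\<And>t x. 0 \<le> t \<Longrightarrow> t \<le> \<delta> \<Longrightarrow> x \<in> V \<Longrightarrow> nrm (T t x) \<le> K * nrm x"
proof (rule ccontr)
  assume "\<not> thesis"
  then have no: "\<And>\<delta> K. \<delta> > 0 \<Longrightarrow> K \<ge> 0 \<Longrightarrow> \<exists>t x. 0 \<le> t \<and> t \<le> \<delta> \<and> x \<in> V \<and> \<not> nrm (T t x) \<le> K * nrm x"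
    using that by metis
  have "\<exists>t. 0 \<le> t \<and> t \<le> 1 / real (Suc n) \<and> (\<exists>x\<in>V. 3 * real n * 4 ^ n * nrm x < nrm (T t x))" for n
    using no[of "1 / real (Suc n)" "3 * real n * 4 ^ n"] by (auto simp: not_le)
  then obtain t where t: "\<And>n. 0 \<le> t n" "\<And>n. t n \<le> 1 / real (Suc n)"
    and large: "\<And>n. \<exists>x\<in>V. 3 * real n * 4 ^ n * nrm x < nrm (T (t n) x)"
    by metis
  obtain z where z: "z \<in> V" "\<And>n. real n \<le> nrm (T (t n) z)"
    using gliding_hump[of "\<lambda>n. T (t n)"] T_op t large by metis
  have "eventually (\<lambda>t. nrm (T t z - z) < 1) (at_right 0)"
    using T_cont[OF z(1)] by (auto intro: order_tendstoD(2))
  then obtain d where d: "d > 0" "\<And>t. 0 < t \<Longrightarrow> t < d \<Longrightarrow> nrm (T t z - z) < 1"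
    unfolding eventually_at_right_field by auto
  obtain n :: nat where n: "real n > 1 / d" "real n > nrm z + 1"
    using reals_Archimedean2[of "max (1 / d) (nrm z + 1)"] by auto
  have "1 / real (Suc n) < d" using n d by (simp add: field_simps)
  then have "nrm (T (t n) z - z) < 1" using d(2)[of "t n"] t[of n] T_0[OF z(1)] by (cases "t n = 0") auto
  then have "nrm (T (t n) z) < nrm z + 1" using nrm_triangle_sub[of "T (t n) z" z] z t by fastforce
  then show False using z(2)[of n] n by linarith
qed

text \<open>The generator commutes with the semigroup.\<close>

lemma gen_invariant:
  assumes x: "gen x w" and t: "0 \<le> t"
  shows "gen (T t x) (T t w)"
proof -
  have [simp]: "x \<in> V" "w \<in> V" using x by (auto simp: gen_def)
  obtain K where K: "0 \<le> K" "\<And>x. x \<in> V \<Longrightarrow> nrm (T t x) \<le> K * nrm x"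
    using bdd_op_bound[OF T_op[OF t]] by blast
  have "((\<lambda>h. K * nrm ((T h x - x) /\<^sub>R h - w)) \<longlongrightarrow> 0) (at_right 0)"
    using x by (intro tendsto_mult_right_zero) (simp add: gen_def)
  moreover have "eventually (\<lambda>h. norm (nrm ((T h (T t x) - T t x) /\<^sub>R h - T t w))
      \<le> K * nrm ((T h x - x) /\<^sub>R h - w)) (at_right 0)"
    using eventually_at_right_less[of "0::real"]
  proof eventually_elim
    case (elim h)
    let ?d = "(T h x - x) /\<^sub>R h"
    have [simp]: "0 \<le> h" using elim by simp
    have [simp]: "T h x \<in> V" "?d \<in> V" "T t (T h x) \<in> V" "T h (T t x) \<in> V" "T t x \<in> V" "T t w \<in> V"
      "T t (T h x - x) \<in> V" "T t ?d \<in> V"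
      using t by auto
    have "nrm (T h (T t x) - T t (T h x)) = 0"
    proof -
      have "nrm (T h (T t x) - T (h + t) x) = 0" "nrm (T (h + t) x - T t (T h x)) = 0"
        using T_add[of h t x] T_add[of t h x] t nrm_minus_commute[of "T h (T t x)" "T (h + t) x"]
        by (auto simp: add.commute)
      then show ?thesis
        by (rule nrm_null_trans[rotated 3]) (use t in auto)
    qed
    moreover have "nrm ((T t (T h x) - T t x) - T t (T h x - x)) = 0"
      using bdd_op_diff[OF T_op[OF t], of "T h x" x] nrm_minus_commute by simp
    moreover have "(T h (T t x) - T t x) - (T t (T h x) - T t x) = T h (T t x) - T t (T h x)"
      by simp
    ultimately have "nrm ((T h (T t x) - T t x) - T t (T h x - x)) = 0"
      using nrm_null_trans[of "T h (T t x) - T t x" "T t (T h x) - T t x" "T t (T h x - x)"] by simp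
    then have "nrm (inverse h *\<^sub>R ((T h (T t x) - T t x) - T t (T h x - x))) = 0"
      by (simp add: nrm_scale)
    then have "nrm ((T h (T t x) - T t x) /\<^sub>R h - inverse h *\<^sub>R T t (T h x - x)) = 0"
      by (simp only: scaleR_diff_right)
    moreover have "nrm (inverse h *\<^sub>R T t (T h x - x) - T t ?d) = 0"
      using T_op[OF t] nrm_minus_commute[of "T t ?d" "inverse h *\<^sub>R T t (T h x - x)"]
      by (simp add: bdd_op_def)
    ultimately have "nrm ((T h (T t x) - T t x) /\<^sub>R h - T t ?d) = 0"
      by (rule nrm_null_trans[rotated 3]) auto
    then have "nrm ((T h (T t x) - T t x) /\<^sub>R h - T t w) \<le> nrm (T t ?d - T t w)"
      using nrm_triangle_mid[of "(T h (T t x) - T t x) /\<^sub>R h" "T t ?d" "T t w"] by simp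
    also have "\<dots> = nrm (T t (?d - w))" by (rule bdd_op_nrm_diff[OF T_op[OF t]]) auto
    also have "\<dots> \<le> K * nrm (?d - w)" by (rule K) auto
    finally show ?case by simp
  qed
  ultimately have "((\<lambda>h. nrm ((T h (T t x) - T t x) /\<^sub>R h - T t w)) \<longlongrightarrow> 0) (at_right 0)"
    by (rule Lim_null_comparison[rotated])
  then show ?thesis using t by (simp add: gen_def)
qed

lemma right_derivative:
  assumes x: "gen x w" and t: "0 \<le> t"
  shows "((\<lambda>h. nrm ((T (t + h) x - T t x) /\<^sub>R h - T t w)) \<longlongrightarrow> 0) (at_right 0)"
proof -
  have [simp]: "x \<in> V" "w \<in> V" using x by (auto simp: gen_def)
  have "((\<lambda>h. nrm ((T h (T t x) - T t x) /\<^sub>R h - T t w)) \<longlongrightarrow> 0) (at_right 0)"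
    using gen_invariant[OF x t] by (simp add: gen_def)
  moreover have "eventually (\<lambda>h. nrm ((T h (T t x) - T t x) /\<^sub>R h - T t w) =
      nrm ((T (t + h) x - T t x) /\<^sub>R h - T t w)) (at_right 0)"
    using eventually_at_right_less[of "0::real"]
  proof eventually_elim
    case (elim h)
    have [simp]: "0 \<le> h" using elim by simp
    have "((T h (T t x) - T t x) /\<^sub>R h - T t w) - ((T (t + h) x - T t x) /\<^sub>R h - T t w) =
        inverse h *\<^sub>R (T h (T t x) - T (t + h) x)"
      by (simp add: algebra_simps)
    moreover have "nrm (T h (T t x) - T (t + h) x) = 0"
      using T_add[of h t x] t nrm_minus_commute[of "T h (T t x)" "T (t + h) x"]
      by (simp add: add.commute)
    ultimately show ?case using t by (intro nrm_eqI) (auto simp: nrm_scale)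
  qed
  ultimately show ?thesis by (rule Lim_transform_eventually)
qed

text \<open>
  For \<open>s\<close> slightly below \<open>t\<close>, write \<open>T s = T a \<circ> T r\<close> and \<open>T t = T a \<circ> T r \<circ> T (t - s)\<close> with a fixed \<open>a\<close> and
  with \<open>r\<close> in the interval on which the operator norms are uniformly bounded.
\<close>

lemma left_continuous:
  assumes x: "x \<in> V" and t: "0 < t"
  shows "((\<lambda>s. nrm (T s x - T t x)) \<longlongrightarrow> 0) (at_left t)"
proof -
  obtain \<delta> K where \<delta>: "\<delta> > 0" "K \<ge> 0" and K: "\<And>t x. 0 \<le> t \<Longrightarrow> t \<le> \<delta> \<Longrightarrow> x \<in> V \<Longrightarrow> nrm (T t x) \<le> K * nrm x"
    using locally_bounded by blast
  define a where "a = max 0 (t - \<delta>)"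
  have a: "0 \<le> a" "a < t" "t - a \<le> \<delta>" using t \<delta> by (auto simp: a_def)
  obtain L where L: "0 \<le> L" "\<And>x. x \<in> V \<Longrightarrow> nrm (T a x) \<le> L * nrm x"
    using bdd_op_bound[OF T_op[OF a(1)]] by blast
  have lim: "((\<lambda>s. nrm (T (t - s) x - x)) \<longlongrightarrow> 0) (at_left t)"
  proof -
    have "filterlim (\<lambda>s. t - s) (at_right 0) (at_left t)"
      unfolding filterlim_at
    proof
      show "eventually (\<lambda>s. t - s \<in> {0<..} \<and> t - s \<noteq> 0) (at_left t)"
        using eventually_at_left_real[of "t - 1" t] by (auto elim: eventually_mono)
      have "((\<lambda>s. t - s) \<longlongrightarrow> t - t) (at_left t)" by (intro tendsto_intros)
      then show "((\<lambda>s. t - s) \<longlongrightarrow> 0) (at_left t)" by simp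
    qed
    then show ?thesis by (rule filterlim_compose[OF T_cont[OF x]])
  qed
  have "((\<lambda>s. L * (K * nrm (T (t - s) x - x))) \<longlongrightarrow> 0) (at_left t)"
    by (intro tendsto_mult_right_zero lim)
  moreover have "eventually (\<lambda>s. norm (nrm (T s x - T t x)) \<le> L * (K * nrm (T (t - s) x - x))) (at_left t)"
    using eventually_at_left_real[OF a(2)]
  proof eventually_elim
    case (elim s)
    define r where "r = s - a"
    have r: "0 \<le> r" "0 \<le> t - s" "r \<le> \<delta>" "s = a + r" "t = a + (r + (t - s))"
      using elim a by (auto simp: r_def)
    define y where "y = T (t - s) x"
    have [simp]: "y \<in> V" "T r y \<in> V" "T r x \<in> V" "T s x \<in> V" "T t x \<in> V"
      "T (r + (t - s)) x \<in> V" "T a (T r x) \<in> V" "T a (T (r + (t - s)) x) \<in> V"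
      using r x t a by (auto simp: y_def)
    have 1: "nrm (T s x - T a (T r x)) = 0" using T_add[OF a(1) r(1) x] unfolding r(4)[symmetric] .
    have 2: "nrm (T a (T (r + (t - s)) x) - T t x) = 0"
    proof -
      have "nrm (T (a + (r + (t - s))) x - T a (T (r + (t - s)) x)) = 0"
        using r a x by (intro T_add) auto
      then show ?thesis
        unfolding r(5)[symmetric] using nrm_minus_commute[of "T t x" "T a (T (r + (t - s)) x)"] by simp
    qed
    have 3: "nrm (T (r + (t - s)) x - T r y) = 0"
      unfolding y_def by (rule T_add[OF r(1,2) x])
    have "nrm (T s x - T t x) \<le> nrm (T a (T r x) - T a (T (r + (t - s)) x))"
      using 1 2 nrm_triangle_mid[of "T s x" "T a (T r x)" "T t x"]
        nrm_triangle_mid[of "T a (T r x)" "T a (T (r + (t - s)) x)" "T t x"] by simp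
    also have "\<dots> = nrm (T a (T r x - T (r + (t - s)) x))"
      by (rule bdd_op_nrm_diff[OF T_op[OF a(1)]]) auto
    also have "\<dots> \<le> L * nrm (T r x - T (r + (t - s)) x)" by (rule L) auto
    also have "\<dots> \<le> L * nrm (T r y - T r x)"
      using L(1) 3 nrm_triangle_mid[of "T r x" "T r y" "T (r + (t - s)) x"]
        nrm_minus_commute[of "T r x" "T r y"] nrm_minus_commute[of "T r y" "T (r + (t - s)) x"]
      by (intro mult_left_mono) auto
    also have "\<dots> = L * nrm (T r (y - x))"
      using x by (subst bdd_op_nrm_diff[OF T_op[OF r(1)]]) auto
    also have "\<dots> \<le> L * (K * nrm (y - x))"
      using x r L by (intro mult_left_mono K) auto
    finally show ?case using t x elim a by (simp add: y_def)
  qed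
  ultimately show ?thesis
    by (rule Lim_null_comparison[rotated])
qed

end

text \<open>A monotonicity criterion with one-sided hypotheses, proved by continuous induction.\<close>

lemma one_sided_nonincreasing:
  fixes \<phi> :: "real \<Rightarrow> real"
  assumes pos: "\<And>t. 0 \<le> t \<Longrightarrow> 0 \<le> \<phi> t"
    and right: "\<And>t \<epsilon>. 0 \<le> t \<Longrightarrow> 0 < \<epsilon> \<Longrightarrow>
      eventually (\<lambda>h. (\<phi> (t + h))\<^sup>2 \<le> (\<phi> t)\<^sup>2 + \<epsilon> * h) (at_right 0)"
    and left: "\<And>t \<epsilon>. 0 < t \<Longrightarrow> 0 < \<epsilon> \<Longrightarrow> eventually (\<lambda>s. \<phi> t \<le> \<phi> s + \<epsilon>) (at_left t)"
    and t: "0 \<le> t"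
  shows "\<phi> t \<le> \<phi> 0"
proof -
  have bound: "(\<phi> t)\<^sup>2 \<le> (\<phi> 0)\<^sup>2 + \<epsilon> * t" if \<epsilon>: "\<epsilon> > 0" for \<epsilon>
  proof -
    define P where "P = (\<lambda>s. (\<phi> s)\<^sup>2 \<le> (\<phi> 0)\<^sup>2 + \<epsilon> * s)"
    define A where "A = {s. 0 \<le> s \<and> s \<le> t \<and> (\<forall>r. 0 \<le> r \<and> r \<le> s \<longrightarrow> P r)}"
    define c where "c = Sup A"
    have "0 \<in> A" using t by (auto simp: A_def P_def)
    have bdd: "bdd_above A" by (auto simp: A_def intro!: bdd_aboveI[of _ t])
    have c: "0 \<le> c" "c \<le> t"
      unfolding c_def using \<open>0 \<in> A\<close> bdd by (auto intro!: cSup_upper cSup_least simp: A_def)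
    have below: "P r" if r: "0 \<le> r" "r < c" for r
    proof -
      obtain s where "s \<in> A" "r < s" using less_cSupD[of A r] \<open>0 \<in> A\<close> r(2) by (auto simp: c_def)
      then show ?thesis using r by (auto simp: A_def)
    qed
    have Pc: "P c"
    proof (cases "c = 0")
      case True
      then show ?thesis using \<open>0 \<in> A\<close> by (auto simp: A_def)
    next
      case False
      then have cp: "0 < c" using c by simp
      define b where "b = sqrt ((\<phi> 0)\<^sup>2 + \<epsilon> * c)"
      have "\<phi> c \<le> b"
      proof (rule field_le_epsilon)
        fix e :: real assume "e > 0"
        have "eventually (\<lambda>s. \<phi> c \<le> \<phi> s + e) (at_left c)" using left cp \<open>e > 0\<close> by blast
        moreover have "eventually (\<lambda>s. s \<in> {0<..<c}) (at_left c)"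
          using cp by (rule eventually_at_left_real)
        ultimately have "eventually (\<lambda>s. \<phi> c \<le> b + e) (at_left c)"
        proof eventually_elim
          case (elim s)
          then have "(\<phi> s)\<^sup>2 \<le> (\<phi> 0)\<^sup>2 + \<epsilon> * s" using below[of s] by (auto simp: P_def)
          also have "\<dots> \<le> (\<phi> 0)\<^sup>2 + \<epsilon> * c" using elim \<epsilon> by simp
          finally have "\<phi> s \<le> b" unfolding b_def by (rule real_le_rsqrt)
          then show ?case using elim by simp
        qed
        then show "\<phi> c \<le> b + e" by (simp add: eventually_const)
      qed
      then have "(\<phi> c)\<^sup>2 \<le> b\<^sup>2" using pos c by (intro power_mono) auto
      also have "b\<^sup>2 = (\<phi> 0)\<^sup>2 + \<epsilon> * c" unfolding b_def using \<epsilon> cp by simp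
      finally show ?thesis by (simp add: P_def)
    qed
    have "c = t"
    proof (rule ccontr)
      assume "c \<noteq> t"
      then have ct: "c < t" using c by simp
      have "eventually (\<lambda>h. (\<phi> (c + h))\<^sup>2 \<le> (\<phi> c)\<^sup>2 + \<epsilon> * h) (at_right 0)" using right c \<epsilon> by blast
      then obtain d where d: "d > 0" "\<And>h. 0 < h \<Longrightarrow> h < d \<Longrightarrow> (\<phi> (c + h))\<^sup>2 \<le> (\<phi> c)\<^sup>2 + \<epsilon> * h"
        unfolding eventually_at_right_field by auto
      define s where "s = min t (c + d / 2)"
      have "P r" if "0 \<le> r" "r \<le> s" for r
      proof -
        consider "r < c" | "r = c" | "c < r" by linarith
        then show ?thesis
        proof cases
          case 3
          then have "(\<phi> r)\<^sup>2 \<le> (\<phi> c)\<^sup>2 + \<epsilon> * (r - c)"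
            using d(2)[of "r - c"] d(1) that by (auto simp: s_def)
          then show ?thesis using Pc by (simp add: P_def algebra_simps)
        qed (use below Pc that in auto)
      qed
      then have "s \<in> A" using c d ct by (auto simp: A_def s_def)
      then have "s \<le> c" unfolding c_def using bdd by (rule cSup_upper)
      then show False using ct d by (auto simp: s_def)
    qed
    then show ?thesis using Pc by (simp add: P_def)
  qed
  have "(\<phi> t)\<^sup>2 \<le> (\<phi> 0)\<^sup>2"
  proof (rule field_le_epsilon)
    fix e :: real assume "e > 0"
    have "e / (t + 1) * t \<le> e" using \<open>e > 0\<close> t by (simp add: field_simps)
    then show "(\<phi> t)\<^sup>2 \<le> (\<phi> 0)\<^sup>2 + e" using bound[of "e / (t + 1)"] \<open>e > 0\<close> t by force
  qed
  then show ?thesis using pos by (auto intro: power2_le_imp_le)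
qed

section \<open>Square-integrable functions\<close>

lemma fun_pointwise: "(f :: 'a \<Rightarrow> real) + g = (\<lambda>x. f x + g x)" "f - g = (\<lambda>x. f x - g x)"
  "c *\<^sub>R f = (\<lambda>x. c * f x)" "- f = (\<lambda>x. - f x)"
  by (auto simp: fun_eq_iff scaleR_fun_def)

lemma L2_measurable: "f \<in> L2 M \<Longrightarrow> f \<in> borel_measurable M"
  by (simp add: L2_def)

lemma L2_integrable_sq: "f \<in> L2 M \<Longrightarrow> integrable M (\<lambda>x. (f x)\<^sup>2)"
  by (simp add: L2_def)

lemma L2_integrable_mult:
  assumes "f \<in> L2 M" "g \<in> L2 M"
  shows "integrable M (\<lambda>x. f x * g x)"
proof (rule Bochner_Integration.integrable_bound)
  show "integrable M (\<lambda>x. (f x)\<^sup>2 + (g x)\<^sup>2)"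
    using assms by (auto intro: L2_integrable_sq)
  show "(\<lambda>x. f x * g x) \<in> borel_measurable M"
    by (intro borel_measurable_times L2_measurable assms)
  have "\<bar>a * b\<bar> \<le> a\<^sup>2 + b\<^sup>2" for a b :: real
  proof -
    have "2 * (\<bar>a\<bar> * \<bar>b\<bar>) \<le> a\<^sup>2 + b\<^sup>2" using sum_squares_bound[of "\<bar>a\<bar>" "\<bar>b\<bar>"] by simp
    moreover have "0 \<le> \<bar>a\<bar> * \<bar>b\<bar>" by simp
    ultimately show ?thesis unfolding abs_mult by linarith
  qed
  then show "AE x in M. norm (f x * g x) \<le> norm ((f x)\<^sup>2 + (g x)\<^sup>2)"
    by (intro AE_I2) (auto intro: order_trans)
qed

lemma L2_add: "f \<in> L2 M \<Longrightarrow> g \<in> L2 M \<Longrightarrow> f + g \<in> L2 M"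
  using L2_integrable_sq[of f M] L2_integrable_sq[of g M] L2_integrable_mult[of f M g]
  by (auto simp: L2_def fun_pointwise power2_sum mult.assoc)

lemma L2_scale: "f \<in> L2 M \<Longrightarrow> c *\<^sub>R f \<in> L2 M"
  by (auto simp: L2_def fun_pointwise power_mult_distrib)

lemma L2_zero: "0 \<in> L2 M"
  by (simp add: L2_def zero_fun_def)

lemma L2_bound:
  assumes "f \<in> L2 M" "g \<in> borel_measurable M" "AE x in M. \<bar>g x\<bar> \<le> \<bar>f x\<bar>"
  shows "g \<in> L2 M"
proof -
  have "integrable M (\<lambda>x. (g x)\<^sup>2)"
  proof (rule Bochner_Integration.integrable_bound[OF L2_integrable_sq[OF assms(1)]])
    show "AE x in M. norm ((g x)\<^sup>2) \<le> norm ((f x)\<^sup>2)"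
      using assms(3) by eventually_elim (simp add: abs_le_square_iff)
  qed (use assms in simp)
  then show ?thesis using assms by (simp add: L2_def)
qed

interpretation l2: semi_inner "L2 M" "l2inner M"
  rewrites "semi_inner.nrm (l2inner M) = l2norm M" for M
proof -
  show *: "semi_inner (L2 M) (l2inner M)"
  proof
    show "subspace (L2 M)"
      by (auto simp: subspace_def L2_add L2_scale L2_zero)
    fix x y z assume "x \<in> L2 M" "y \<in> L2 M" "z \<in> L2 M"
    then show "l2inner M (x + y) z = l2inner M x z + l2inner M y z"
      by (simp add: l2inner_def algebra_simps L2_integrable_mult)
  next
    fix x z c
    show "l2inner M (c *\<^sub>R x) z = c * l2inner M x z"
      by (simp add: l2inner_def fun_pointwise mult.assoc)
  qed (auto simp: l2inner_def mult.commute)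
  show "semi_inner.nrm (l2inner M) = l2norm M"
    by (rule ext) (simp add: semi_inner.nrm_def[OF *] l2norm_def l2inner_def power2_eq_square)
qed

lemma l2norm_eq_0_iff:
  assumes "f \<in> L2 M"
  shows "l2norm M f = 0 \<longleftrightarrow> (AE x in M. f x = 0)"
  using integral_nonneg_eq_0_iff_AE[OF L2_integrable_sq[OF assms]]
  by (simp add: l2norm_def)

lemma nn_integral_sq:
  assumes "f \<in> L2 M"
  shows "(\<integral>\<^sup>+x. ennreal ((f x)\<^sup>2) \<partial>M) = ennreal ((l2norm M f)\<^sup>2)"
  using nn_integral_eq_integral[OF L2_integrable_sq[OF assms]] by (simp add: l2norm_def)

lemma l2norm_abs_le:
  assumes "g \<in> L2 M" "AE x in M. \<bar>f x\<bar> \<le> \<bar>g x\<bar>" "f \<in> borel_measurable M"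
  shows "l2norm M f \<le> l2norm M g"
proof -
  have "f \<in> L2 M" using L2_bound assms by blast
  then show ?thesis
    unfolding l2norm_def using assms
    by (intro real_sqrt_le_mono integral_mono_AE L2_integrable_sq)
      (auto elim!: eventually_mono simp: abs_le_square_iff)
qed

text \<open>
  Completeness (Riesz-Fischer): the sum of the absolute increments is square integrable by monotone
  convergence, so the sequence converges almost everywhere, and Fatou's lemma gives the norm bound.
\<close>

lemma L2_complete:
  fixes u :: "nat \<Rightarrow> 'a \<Rightarrow> real"
  assumes u: "\<And>n. u n \<in> L2 M" and inc: "\<And>n. l2norm M (u (Suc n) - u n) \<le> (1/2) ^ n"
  shows "\<exists>v\<in>L2 M. (\<lambda>n. l2norm M (u n - v)) \<longlonglongrightarrow> 0"
proof -
  have [measurable]: "u n \<in> borel_measurable M" for n using u by (rule L2_measurable)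
  define d where "d = (\<lambda>n x. \<bar>u (Suc n) x - u n x\<bar>)"
  have dL: "d n \<in> L2 M" for n
    unfolding d_def by (rule L2_bound[of "u (Suc n) - u n"]) (use u in auto)
  have dn: "l2norm M (d n) \<le> (1/2) ^ n" for n
    using inc[of n] by (simp add: d_def l2norm_def)
  define g where "g = (\<lambda>N x. \<Sum>n<N. d n x)"
  have g_Suc: "g (Suc N) = g N + d N" for N by (simp add: g_def fun_eq_iff)
  have gL: "g N \<in> L2 M" for N
  proof (induction N)
    case 0
    have "g 0 = 0" by (simp add: g_def fun_eq_iff)
    then show ?case by (simp only: L2_zero)
  next
    case (Suc N)
    then show ?case unfolding g_Suc by (intro L2_add dL)
  qed
  have gn: "l2norm M (g N) \<le> 2 - 2 * (1/2) ^ N" for N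
  proof (induction N)
    case 0
    show ?case by (simp add: g_def l2norm_def)
  next
    case (Suc N)
    have "l2norm M (g (Suc N)) \<le> l2norm M (g N) + l2norm M (d N)"
      unfolding g_Suc by (rule l2.nrm_triangle[OF gL dL])
    then show ?case using Suc dn[of N] by simp
  qed
  have [measurable]: "g N \<in> borel_measurable M" for N using gL by (rule L2_measurable)
  have g_nonneg: "0 \<le> g N x" for N x unfolding g_def d_def by (simp add: sum_nonneg)
  have inc_g: "incseq (\<lambda>N x. ennreal ((g N x)\<^sup>2))"
  proof (intro incseq_SucI le_funI ennreal_leI power_mono)
    fix N x show "g N x \<le> g (Suc N) x" by (simp add: g_Suc d_def)
  qed (rule g_nonneg)
  have "(\<integral>\<^sup>+x. (SUP N. ennreal ((g N x)\<^sup>2)) \<partial>M) = (SUP N. \<integral>\<^sup>+x. ennreal ((g N x)\<^sup>2) \<partial>M)"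
    by (rule nn_integral_monotone_convergence_SUP[OF inc_g]) measurable
  also have "\<dots> \<le> ennreal (2\<^sup>2)"
  proof (rule SUP_least)
    fix N
    have "l2norm M (g N) \<le> 2" using gn[of N] zero_le_power[of "1/2::real" N] by linarith
    then show "(\<integral>\<^sup>+x. ennreal ((g N x)\<^sup>2) \<partial>M) \<le> ennreal (2\<^sup>2)"
      unfolding nn_integral_sq[OF gL] using gL by (intro ennreal_leI power_mono) simp_all
  qed
  finally have "(\<integral>\<^sup>+x. (SUP N. ennreal ((g N x)\<^sup>2)) \<partial>M) \<noteq> \<infinity>"
    using ennreal_less_top[of "2\<^sup>2"] by (metis infinity_ennreal_def leD)
  then have "AE x in M. (SUP N. ennreal ((g N x)\<^sup>2)) \<noteq> \<infinity>"
    by (intro nn_integral_PInf_AE) measurable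
  then have conv: "AE x in M. (\<lambda>n. u n x) \<longlonglongrightarrow> lim (\<lambda>n. u n x)"
  proof eventually_elim
    case (elim x)
    then obtain B where B: "(SUP N. ennreal ((g N x)\<^sup>2)) = ennreal B" "0 \<le> B"
      by (cases "SUP N. ennreal ((g N x)\<^sup>2)") auto
    have "(\<Sum>n<N. d n x) \<le> sqrt B" for N
    proof -
      have "ennreal ((g N x)\<^sup>2) \<le> ennreal B" unfolding B(1)[symmetric] by (rule SUP_upper) simp
      then have "(g N x)\<^sup>2 \<le> B" using B(2) by simp
      then show ?thesis by (simp add: g_def real_le_rsqrt)
    qed
    then have "summable (\<lambda>n. d n x)"
      by (intro summableI_nonneg_bounded) (auto simp: d_def)
    then have "summable (\<lambda>n. u (Suc n) x - u n x)"
      by (intro summable_norm_cancel[of "\<lambda>n. u (Suc n) x - u n x"]) (simp add: d_def)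
    then have "convergent (\<lambda>m. \<Sum>n<m. u (Suc n) x - u n x)" by (simp add: summable_iff_convergent)
    then have "convergent (\<lambda>m. u m x - u 0 x)"
      by (simp add: sum_lessThan_telescope[of "\<lambda>n. u n x"])
    then have "convergent (\<lambda>m. u m x - u 0 x + u 0 x)" by (intro convergent_add convergent_const)
    then show ?case by (simp add: convergent_LIMSEQ_iff)
  qed
  define v where "v = (\<lambda>x. lim (\<lambda>n. u n x))"
  have [measurable]: "v \<in> borel_measurable M"
    unfolding v_def by (rule borel_measurable_lim_metric) measurable
  have est: "(\<integral>\<^sup>+x. ennreal ((u n x - v x)\<^sup>2) \<partial>M) \<le> ennreal ((2 * (1/2) ^ n)\<^sup>2)" for n
  proof -
    have "(\<integral>\<^sup>+x. ennreal ((u n x - v x)\<^sup>2) \<partial>M) =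
        (\<integral>\<^sup>+x. liminf (\<lambda>m. ennreal ((u n x - u m x)\<^sup>2)) \<partial>M)"
    proof (rule nn_integral_cong_AE)
      show "AE x in M. ennreal ((u n x - v x)\<^sup>2) = liminf (\<lambda>m. ennreal ((u n x - u m x)\<^sup>2))"
        using conv
      proof eventually_elim
        case (elim x)
        have "(\<lambda>m. ennreal ((u n x - u m x)\<^sup>2)) \<longlonglongrightarrow> ennreal ((u n x - v x)\<^sup>2)"
          unfolding v_def by (intro tendsto_intros tendsto_ennrealI elim)
        from lim_imp_Liminf[OF trivial_limit_sequentially this] show ?case by (rule sym)
      qed
    qed
    also have "\<dots> \<le> liminf (\<lambda>m. \<integral>\<^sup>+x. ennreal ((u n x - u m x)\<^sup>2) \<partial>M)"
      by (rule nn_integral_liminf) measurable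
    also have "\<dots> \<le> liminf (\<lambda>m. ennreal ((2 * (1/2) ^ n)\<^sup>2))"
    proof (rule Liminf_mono)
      show "eventually (\<lambda>m. (\<integral>\<^sup>+x. ennreal ((u n x - u m x)\<^sup>2) \<partial>M) \<le> ennreal ((2 * (1/2) ^ n)\<^sup>2))
          sequentially"
        using eventually_ge_at_top[of n]
      proof eventually_elim
        case (elim m)
        have "l2norm M (u m - u n) \<le> 2 * (1/2) ^ n"
          using l2.geometric_increments[of u M "1/2" n m] u inc elim by simp
        then have "(l2norm M (u n - u m))\<^sup>2 \<le> (2 * (1/2) ^ n)\<^sup>2"
          using l2.nrm_minus_commute[OF u u, of n m] u by (intro power_mono) auto
        moreover have "(\<integral>\<^sup>+x. ennreal ((u n x - u m x)\<^sup>2) \<partial>M) = ennreal ((l2norm M (u n - u m))\<^sup>2)"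
          using nn_integral_sq[of "u n - u m" M] u by simp
        ultimately show ?case by (simp add: ennreal_leI)
      qed
    qed
    also have "\<dots> = ennreal ((2 * (1/2) ^ n)\<^sup>2)" by (simp add: Liminf_const)
    finally show ?thesis .
  qed
  have diffL: "u n - v \<in> L2 M" for n
  proof -
    have "integrable M (\<lambda>x. (u n x - v x)\<^sup>2)"
      by (rule integrableI_bounded) (auto intro!: le_less_trans[OF est[of n]])
    then show ?thesis by (simp add: L2_def fun_pointwise)
  qed
  have "v \<in> L2 M" using l2.V_closed(3)[OF u diffL, of 0 0] by simp
  moreover have "(\<lambda>n. l2norm M (u n - v)) \<longlonglongrightarrow> 0"
  proof (rule Lim_null_comparison[OF always_eventually])
    show "\<forall>n. norm (l2norm M (u n - v)) \<le> 2 * (1/2) ^ n"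
    proof
      fix n
      have "ennreal ((l2norm M (u n - v))\<^sup>2) \<le> ennreal ((2 * (1/2) ^ n)\<^sup>2)"
        using est[of n] nn_integral_sq[OF diffL, of n] by simp
      then have "(l2norm M (u n - v))\<^sup>2 \<le> (2 * (1/2) ^ n)\<^sup>2"
        by (subst (asm) ennreal_le_iff) auto
      then have "l2norm M (u n - v) \<le> 2 * (1/2) ^ n" by (rule power2_le_imp_le) simp
      then show "norm (l2norm M (u n - v)) \<le> 2 * (1/2) ^ n"
        using l2.nrm_nonneg[OF diffL] by simp
    qed
    show "(\<lambda>n. 2 * (1/2::real) ^ n) \<longlonglongrightarrow> 0"
      by (intro tendsto_mult_right_zero LIMSEQ_power_zero) auto
  qed
  ultimately show ?thesis by blast
qed

interpretation l2: semi_hilbert "L2 M" "l2inner M"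
  rewrites "semi_inner.nrm (l2inner M) = l2norm M" for M
proof -
  show eq: "semi_inner.nrm (l2inner M) = l2norm M"
    by (rule ext) (simp add: semi_inner.nrm_def[OF l2.semi_inner_axioms] l2norm_def l2inner_def power2_eq_square)
  show "semi_hilbert (L2 M) (l2inner M)"
    by standard (unfold eq, rule L2_complete)
qed

section \<open>Dirichlet forms as semi-inner products\<close>

lemma l2norm_sq: "(l2norm M f)\<^sup>2 = l2inner M f f"
  by (simp add: l2norm_def l2inner_def power2_eq_square)

context dirichlet_form
begin

lemma D_subspace: "subspace D"
proof -
  obtain f where "f \<in> D" using D_dense[OF L2_zero, of 1] by auto
  then have "0 \<in> D" using D_scale[of f 0] by (simp add: zero_fun_def)
  then show ?thesis using D_add D_scale by (auto simp: subspace_def fun_pointwise)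
qed

sublocale energy: semi_inner D E
proof
  show "subspace D" by (rule D_subspace)
qed (use E_sym E_add E_scale E_nonneg in \<open>auto simp: fun_pointwise\<close>)

lemma D_in_L2 [simp]: "f \<in> D \<Longrightarrow> f \<in> L2 M"
  using D_L2 by auto

sublocale e1: semi_inner D "\<lambda>f g. E f g + l2inner M f g"
  rewrites "semi_inner.nrm (\<lambda>f g. E f g + l2inner M f g) = E1norm M E"
proof -
  show *: "semi_inner D (\<lambda>f g. E f g + l2inner M f g)"
    by standard (auto simp: D_subspace energy.ip_simps l2.ip_simps algebra_simps E_sym l2.ip_nonneg E_nonneg
        intro: l2.ip_sym)
  show "semi_inner.nrm (\<lambda>f g. E f g + l2inner M f g) = E1norm M E"
    by (rule ext) (simp add: semi_inner.nrm_def[OF *] E1norm_def l2norm_sq)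
qed

lemma E1_complete:
  assumes u: "\<And>n. u n \<in> D" and inc: "\<And>n. E1norm M E (u (Suc n) - u n) \<le> (1/2) ^ n"
  shows "\<exists>v\<in>D. (\<lambda>n. E1norm M E (u n - v)) \<longlonglongrightarrow> 0"
proof -
  have "\<exists>N. \<forall>m\<ge>N. \<forall>n\<ge>N. E1norm M E (\<lambda>x. u m x - u n x) < \<epsilon>" if e: "\<epsilon> > 0" for \<epsilon>
  proof -
    obtain N where N: "(1/2::real) ^ N < \<epsilon> / 4"
      using real_arch_pow_inv[of "\<epsilon> / 4" "1/2"] e by auto
    have "E1norm M E (u m - u n) < \<epsilon>" if "m \<ge> N" "n \<ge> N" for m n
      using e1.geometric_increments[of u "1/2" N m] e1.geometric_increments[of u "1/2" N n]
        e1.nrm_triangle_mid[of "u m" "u N" "u n"] e1.nrm_minus_commute[of "u n" "u N"] u inc that N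
      by simp
    then show ?thesis by (auto simp: fun_pointwise)
  qed
  from E_closed[OF u this] show ?thesis by (simp add: fun_pointwise)
qed

sublocale e1: semi_hilbert D "\<lambda>f g. E f g + l2inner M f g"
  rewrites "semi_inner.nrm (\<lambda>f g. E f g + l2inner M f g) = E1norm M E"
proof -
  show eq: "semi_inner.nrm (\<lambda>f g. E f g + l2inner M f g) = E1norm M E"
    by (rule ext) (simp add: semi_inner.nrm_def[OF e1.semi_inner_axioms] E1norm_def l2norm_sq)
  show "semi_hilbert D (\<lambda>f g. E f g + l2inner M f g)"
    by standard (unfold eq, rule E1_complete)
qed

lemma E1norm_sq: "f \<in> D \<Longrightarrow> (E1norm M E f)\<^sup>2 = E f f + (l2norm M f)\<^sup>2"
  by (simp add: E1norm_def E_nonneg)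

lemma l2norm_le_E1norm: "f \<in> D \<Longrightarrow> l2norm M f \<le> E1norm M E f"
  by (rule power2_le_imp_le) (simp_all add: E1norm_sq E_nonneg)

lemma E_null:
  assumes f: "f \<in> D" and n: "l2norm M f = 0"
  shows "E f f = 0"
proof -
  have "AE x in M. f x = 0 x" using l2norm_eq_0_iff[of f M] f n by simp
  then have "E f f = E 0 f" using E_cong[of f 0 f] f by simp
  then show ?thesis using energy.ip_scale_left[of 0 f 0] f by simp
qed

lemma laplacian_D: "laplacian M D E u w \<Longrightarrow> u \<in> D"
  and laplacian_E: "laplacian M D E u w \<Longrightarrow> v \<in> D \<Longrightarrow> E u v = - l2inner M v w"
  by (auto simp: laplacian_def)

lemma laplacian_add:
  "laplacian M D E u w \<Longrightarrow> laplacian M D E u' w' \<Longrightarrow> laplacian M D E (u + u') (w + w')"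
  by (auto simp: laplacian_def l2.ip_simps energy.ip_simps)

lemma laplacian_scale: "laplacian M D E u w \<Longrightarrow> laplacian M D E (c *\<^sub>R u) (c *\<^sub>R w)"
  by (auto simp: laplacian_def l2.ip_simps energy.ip_simps)

lemma laplacian_zero: "laplacian M D E 0 0"
  using energy.ip_scale_left[of 0 _ 0] l2.ip_scale_right[of 0 M _ 0] by (auto simp: laplacian_def)

lemma laplacian_diff:
  "laplacian M D E u w \<Longrightarrow> laplacian M D E u' w' \<Longrightarrow> laplacian M D E (u - u') (w - w')"
  by (auto simp: laplacian_def l2.ip_simps energy.ip_simps)

text \<open>The resolvent \<open>(1 - \<Delta>)\<^sup>-\<^sup>1\<close>, by the representation of \<open>\<langle>f, \<cdot>\<rangle>\<close> in \<open>Dom \<E>\<close> with inner product \<open>\<E> + \<langle>\<cdot>, \<cdot>\<rangle>\<close>.\<close>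

lemma resolvent:
  assumes f: "f \<in> L2 M"
  obtains v where "laplacian M D E v (v - f)" "\<And>g. g \<in> D \<Longrightarrow> E v g + l2inner M v g = l2inner M f g"
proof -
  have bd: "\<bar>l2inner M f g\<bar> \<le> l2norm M f * E1norm M E g" if "g \<in> D" for g
  proof -
    have "\<bar>l2inner M f g\<bar> \<le> l2norm M f * l2norm M g" using f that by (intro l2.Cauchy_Schwarz) auto
    also have "\<dots> \<le> l2norm M f * E1norm M E g"
      using f that l2norm_le_E1norm by (intro mult_left_mono) auto
    finally show ?thesis .
  qed
  obtain u v where v: "v \<in> D" "\<And>g. g \<in> D \<Longrightarrow> E v g + l2inner M v g = l2inner M f g"
    by (rule e1.representation[of D "l2inner M f" "l2norm M f"])
      (use f bd D_subspace in \<open>auto simp: l2.ip_simps\<close>)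
  have "E v g = - l2inner M g (v - f)" if "g \<in> D" for g
    using v(2)[OF that] that v(1) f by (simp add: l2.ip_simps l2.ip_sym[of _ _ g])
  then have "laplacian M D E v (v - f)" using v f by (auto simp: laplacian_def)
  with v(2) that show thesis by blast
qed

text \<open>
  The domain of the squared generator is the range of the squared resolvent. A vector that is
  orthogonal to it is annihilated by the resolvent, and hence zero.
\<close>

lemma laplacian_squared_dense_E1:
  assumes f: "f \<in> D"
  obtains u w z where "\<And>n. laplacian M D E (u n) (w n)" "\<And>n. laplacian M D E (w n) (z n)"
    "(\<lambda>n. E1norm M E (u n - f)) \<longlonglongrightarrow> 0"
proof -
  define W where "W = {u. \<exists>w z. laplacian M D E u w \<and> laplacian M D E w z}"
  have "subspace W"
    unfolding W_def subspace_def using laplacian_zero laplacian_add laplacian_scale by blast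
  moreover have "W \<subseteq> D" by (auto simp: W_def laplacian_def)
  moreover have "E1norm M E y = 0" if y: "y \<in> D" and orth: "\<And>w. w \<in> W \<Longrightarrow> E y w + l2inner M y w = 0" for y
  proof -
    obtain s where s: "laplacian M D E s (s - y)" "\<And>g. g \<in> D \<Longrightarrow> E s g + l2inner M s g = l2inner M y g"
      using resolvent[of y] y by auto
    have sD: "s \<in> D" using s by (auto simp: laplacian_def)
    obtain v1 where v1: "laplacian M D E v1 (v1 - s)" "\<And>g. g \<in> D \<Longrightarrow> E v1 g + l2inner M v1 g = l2inner M s g"
      using resolvent[of s] sD by auto
    have v1D: "v1 \<in> D" using v1 by (auto simp: laplacian_def)
    obtain v2 where v2: "laplacian M D E v2 (v2 - v1)" "\<And>g. g \<in> D \<Longrightarrow> E v2 g + l2inner M v2 g = l2inner M v1 g"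
      using resolvent[of v1] v1D by auto
    \<comment> \<open>Here \<open>s\<close>, \<open>v1\<close>, \<open>v2\<close> are the first three iterates of the resolvent on \<open>y\<close>; testing \<open>y\<close> against
      \<open>v2\<close> gives the squared norm of \<open>s\<close>, by symmetry of the resolvent.\<close>
    have v2D: "v2 \<in> D" using v2 by (auto simp: laplacian_def)
    have "v2 \<in> W" unfolding W_def using v2(1) laplacian_diff[OF v2(1) v1(1)] by blast
    then have "l2inner M v1 y = 0" using orth v2(2)[OF y] e1.ip_sym[OF y v2D] by simp
    moreover have "l2inner M v1 y = l2inner M s s"
      using s(2)[OF v1D] v1(2)[OF sD] e1.ip_sym[OF sD v1D] l2.ip_sym[of y M v1] y v1D by simp
    ultimately have s0: "l2norm M s = 0" by (simp add: l2norm_def l2inner_def power2_eq_square)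
    then have "E1norm M E s = 0" using E_null[OF sD] by (simp add: E1norm_def)
    then have "E s y + l2inner M s y = 0" by (rule e1.ip_null[OF sD y])
    then have "l2norm M y = 0" using s(2)[OF y] by (simp add: l2norm_def l2inner_def power2_eq_square)
    then show ?thesis using E_null[OF y] by (simp add: E1norm_def)
  qed
  ultimately obtain u where u: "\<And>n. u n \<in> W" "(\<lambda>n. E1norm M E (u n - f)) \<longlonglongrightarrow> 0"
    using e1.dense_if_orthogonal_trivial[of W f] f by blast
  from u(1) have "\<exists>w z. laplacian M D E (u n) w \<and> laplacian M D E w z" for n by (auto simp: W_def)
  then obtain w z where "\<And>n. laplacian M D E (u n) (w n) \<and> laplacian M D E (w n) (z n)" by metis
  with u(2) that show thesis by blast
qed

lemma laplacian_dense_L2: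
  assumes f: "f \<in> L2 M" and e: "\<epsilon> > 0"
  obtains u w where "laplacian M D E u w" "l2norm M (f - u) < \<epsilon>"
proof -
  obtain g where g: "g \<in> D" "l2norm M (f - g) < \<epsilon> / 2"
    using D_dense[OF f, of "\<epsilon> / 2"] e by (auto simp: fun_pointwise)
  obtain u w z where u: "\<And>n. laplacian M D E (u n) (w n)" "(\<lambda>n. E1norm M E (u n - g)) \<longlonglongrightarrow> 0"
    using laplacian_squared_dense_E1[OF g(1)] by metis
  from order_tendstoD(2)[OF u(2), of "\<epsilon> / 2"] e obtain n where n: "E1norm M E (u n - g) < \<epsilon> / 2"
    by (auto simp: eventually_sequentially)
  have un: "u n \<in> D" using u(1)[of n] by (rule laplacian_D)
  have "l2norm M (f - u n) \<le> l2norm M (f - g) + l2norm M (u n - g)"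
    using l2.nrm_triangle_mid[of f M g "u n"] l2.nrm_minus_commute[of g M "u n"] f g un by simp
  also have "\<dots> < \<epsilon>" using g(2) n l2norm_le_E1norm[of "u n - g"] un g(1) by simp
  finally show thesis using that u(1) by blast
qed

end

section \<open>Positivity of the heat semigroup\<close>

text \<open>The negative part, as a nonnegative function.\<close>

definition neg_part :: "('a \<Rightarrow> real) \<Rightarrow> 'a \<Rightarrow> real" where
  "neg_part f = (\<lambda>x. max (- f x) 0)"

lemma neg_part_apply: "neg_part f x = max (- f x) 0"
  by (simp add: neg_part_def)

lemma neg_part_L2 [simp]:
  assumes "f \<in> L2 M"
  shows "neg_part f \<in> L2 M"
proof (rule L2_bound[OF assms])
  show "neg_part f \<in> borel_measurable M"
    unfolding neg_part_def using L2_measurable[OF assms] by measurable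
qed (auto simp: neg_part_apply)

lemma neg_part_lipschitz:
  assumes "f \<in> L2 M" "g \<in> L2 M"
  shows "l2norm M (neg_part f) \<le> l2norm M (neg_part g) + l2norm M (f - g)"
proof -
  have "l2norm M (neg_part f - neg_part g) \<le> l2norm M (f - g)"
    using assms by (intro l2norm_abs_le AE_I2 L2_measurable) (auto simp: neg_part_apply)
  then show ?thesis
    using l2.nrm_triangle_sub[of "neg_part f" M "neg_part g"] assms by simp
qed

context dirichlet_form
begin

text \<open>
  Truncation \<open>u\<^sub>n\<close> of \<open>u\<close> to \<open>[0, n]\<close> does not increase the energy, and expanding
  \<open>E(u - (u - u\<^sub>n)) \<le> E(u)\<close> gives \<open>E(u, u - u\<^sub>n) \<ge> 0\<close>. Here \<open>u - u\<^sub>n\<close> tends to minus the negative part of \<open>u\<close>.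
\<close>

lemma laplacian_neg_part:
  assumes u: "laplacian M D E u w"
  shows "0 \<le> l2inner M w (neg_part u)"
proof -
  have uD: "u \<in> D" and wL: "w \<in> L2 M" using u by (auto simp: laplacian_def)
  have [measurable]: "u \<in> borel_measurable M" "w \<in> borel_measurable M"
    using uD wL by (auto intro: L2_measurable)
  define v where "v = (\<lambda>n x. real (Suc n) * min (max (u x / real (Suc n)) 0) 1)"
  have v_eq: "v n x = min (max (u x) 0) (real (Suc n))" for n x
  proof -
    have "c * min (max (a / c) 0) 1 = min (max a 0) c" if "c > 0" for a c :: real
      using that by (auto simp: min_def max_def field_simps)
    then show ?thesis by (simp add: v_def del: of_nat_Suc)
  qed
  have v_le: "l2inner M w (u - v n) \<le> 0" for n
  proof -
    define c where "c = real (Suc n)"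
    have c: "c > 0" by (simp add: c_def)
    define u' where "u' = (1 / c) *\<^sub>R u"
    define p where "p = (\<lambda>x. min (max (u' x) 0) 1)"
    have u'D: "u' \<in> D" using uD by (auto simp: u'_def)
    have pD: "p \<in> D" unfolding p_def by (rule markov_D[OF u'D])
    have vp: "v n = c *\<^sub>R p" by (simp add: v_def p_def u'_def fun_pointwise c_def)
    have vD: "v n \<in> D" using pD by (auto simp: vp)
    have "E p p \<le> E u' u'" unfolding p_def by (rule markov_E[OF u'D])
    then have "c\<^sup>2 * E p p \<le> c\<^sup>2 * E u' u'" by (intro mult_left_mono) auto
    moreover have "E (v n) (v n) = c\<^sup>2 * E p p"
      using pD by (simp add: vp energy.ip_simps power2_eq_square)
    moreover have "c\<^sup>2 * E u' u' = E u u"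
      using uD c by (simp add: u'_def energy.ip_simps power2_eq_square)
    ultimately have "E (v n) (v n) \<le> E u u" by simp
    moreover have "E (v n) (v n) = E u u - 2 * E u (u - v n) + E (u - v n) (u - v n)"
      using uD vD by (simp add: energy.ip_simps E_sym[of "v n" u])
    ultimately have "0 \<le> E u (u - v n)" using E_nonneg[of "u - v n"] uD vD by auto
    moreover have "E u (u - v n) = - l2inner M (u - v n) w"
      using uD vD by (intro laplacian_E[OF u]) auto
    moreover have "l2inner M (u - v n) w = l2inner M w (u - v n)"
      using uD vD wL by (intro l2.ip_sym) auto
    ultimately show ?thesis by simp
  qed
  have "(\<lambda>n. l2inner M w (u - v n)) \<longlonglongrightarrow> (\<integral>x. w x * - neg_part u x \<partial>M)"
    unfolding l2inner_def
  proof (rule integral_dominated_convergence[where w = "\<lambda>x. \<bar>w x * u x\<bar>"])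
    show "integrable M (\<lambda>x. \<bar>w x * u x\<bar>)"
      using L2_integrable_mult[OF wL, of u] uD by simp
    show "AE x in M. (\<lambda>n. w x * (u - v n) x) \<longlonglongrightarrow> w x * - neg_part u x"
    proof (intro AE_I2 tendsto_mult tendsto_const)
      fix x
      have "eventually (\<lambda>n. (u - v n) x = - neg_part u x) sequentially"
        using eventually_ge_at_top[of "nat \<lceil>\<bar>u x\<bar>\<rceil>"]
      proof eventually_elim
        case (elim n)
        then have "\<bar>u x\<bar> \<le> real (Suc n)" by linarith
        then have "v n x = max (u x) 0" by (simp add: v_eq)
        then show ?case by (simp add: neg_part_apply)
      qed
      then show "(\<lambda>n. (u - v n) x) \<longlonglongrightarrow> - neg_part u x" by (rule tendsto_eventually)
    qed
    have "\<bar>(u - v n) x\<bar> \<le> \<bar>u x\<bar>" for n x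
      by (auto simp: v_eq min_def max_def)
    then show "AE x in M. norm (w x * (u - v n) x) \<le> \<bar>w x * u x\<bar>" for n
      by (auto simp: abs_mult intro!: mult_left_mono)
  next
    show "(\<lambda>x. w x * - neg_part u x) \<in> borel_measurable M" unfolding neg_part_def by measurable
    show "(\<lambda>x. w x * (u - v n) x) \<in> borel_measurable M" for n by (simp add: v_def)
  qed
  then have "(\<integral>x. w x * - neg_part u x \<partial>M) \<le> 0"
    by (rule LIMSEQ_le_const2) (use v_le in auto)
  then show ?thesis by (simp add: l2inner_def)
qed

end

lemma l2norm_diff_0:
  assumes "f \<in> L2 M" "g \<in> L2 M"
  shows "l2norm M (f - g) = 0 \<longleftrightarrow> (AE x in M. f x = g x)"
  using l2norm_eq_0_iff[of "f - g" M] assms by simp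

lemma l2_c0_semigroup_imp_c0_sg:
  assumes "l2_c0_semigroup M A T"
  shows "c0_sg (L2 M) (l2inner M) T"
proof -
  note T = assms[unfolded l2_c0_semigroup_def]
  have TL: "T t f \<in> L2 M" if "0 \<le> t" "f \<in> L2 M" for t f
    using T that by blast
  have eq: "semi_inner.nrm (l2inner M) = l2norm M"
    by (rule ext) (simp add: l2norm_def l2inner_def power2_eq_square semi_inner.nrm_def[OF l2.semi_inner_axioms])
  show ?thesis
  proof (unfold_locales, unfold eq)
    fix t :: real assume t: "0 \<le> t"
    have "AE x in M. T t (f + g) x = (T t f + T t g) x" if "f \<in> L2 M" "g \<in> L2 M" for f g
      using T t that by (simp add: fun_pointwise)
    moreover have "AE x in M. T t (c *\<^sub>R f) x = (c *\<^sub>R T t f) x" if "f \<in> L2 M" for f c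
      using T t that by (simp add: fun_pointwise)
    moreover have "\<exists>K. \<forall>f\<in>L2 M. l2norm M (T t f) \<le> K * l2norm M f" using T t by blast
    ultimately show "semi_inner.bdd_op (L2 M) (l2inner M) (T t)"
      unfolding l2.bdd_op_def using TL t by (auto simp: l2norm_diff_0)
  next
    fix f assume "f \<in> L2 M"
    then show "l2norm M (T 0 f - f) = 0" using T TL by (simp add: l2norm_diff_0)
  next
    fix s t :: real and f assume "0 \<le> s" "0 \<le> t" "f \<in> L2 M"
    then show "l2norm M (T (s + t) f - T s (T t f)) = 0"
      using T TL by (simp add: l2norm_diff_0)
  next
    fix f assume "f \<in> L2 M"
    then show "((\<lambda>t. l2norm M (T t f - f)) \<longlongrightarrow> 0) (at_right 0)"
      using T by (simp add: fun_pointwise)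
  qed
qed

text \<open>A Dirichlet form with the semigroup of its generator.\<close>

locale heat_flow = dirichlet_form M D E
  for M :: "'a::{metric_space, second_countable_topology} measure" and D E +
  fixes T :: "real \<Rightarrow> ('a \<Rightarrow> real) \<Rightarrow> 'a \<Rightarrow> real"
  assumes heat: "l2_c0_semigroup M (laplacian M D E) T"
begin

sublocale heat: c0_sg "L2 M" "l2inner M" T
  rewrites "semi_inner.nrm (l2inner M) = l2norm M"
proof -
  show "c0_sg (L2 M) (l2inner M) T" by (rule l2_c0_semigroup_imp_c0_sg[OF heat])
  show "semi_inner.nrm (l2inner M) = l2norm M"
    by (rule ext) (simp add: l2norm_def l2inner_def power2_eq_square semi_inner.nrm_def[OF l2.semi_inner_axioms])
qed

lemma laplacian_iff_gen: "laplacian M D E f w \<longleftrightarrow> heat.gen f w"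
proof (cases "f \<in> L2 M \<and> w \<in> L2 M")
  case True
  then have "laplacian M D E f w \<longleftrightarrow>
      ((\<lambda>t. l2norm M (\<lambda>x. (T t f x - f x) / t - w x)) \<longlongrightarrow> 0) (at_right 0)"
    using heat unfolding l2_c0_semigroup_def by blast
  then show ?thesis using True by (simp add: heat.gen_def fun_pointwise divide_inverse mult.commute)
next
  case False
  then show ?thesis by (auto simp: heat.gen_def laplacian_def)
qed

lemma laplacian_heat: "laplacian M D E f w \<Longrightarrow> 0 \<le> t \<Longrightarrow> laplacian M D E (T t f) (T t w)"
  using heat.gen_invariant by (simp add: laplacian_iff_gen)

text \<open>
  First for \<open>f\<close> in the domain of \<open>\<Delta>\<close>, by the energy argument; both sides are continuous in \<open>f\<close>.
\<close>

lemma heat_neg_part_le: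
  assumes f: "f \<in> L2 M" and t: "0 \<le> t"
  shows "l2norm M (neg_part (T t f)) \<le> l2norm M (neg_part f)"
proof -
  have smooth: "l2norm M (neg_part (T t f)) \<le> l2norm M (neg_part f)" if lap: "laplacian M D E f w" for f w
  proof -
    have [simp]: "f \<in> L2 M" "w \<in> L2 M" using lap by (auto simp: laplacian_def)
    have "l2norm M (neg_part (T t f)) \<le> l2norm M (neg_part (T 0 f))"
    proof (rule one_sided_nonincreasing[OF _ _ _ t])
      fix t :: real assume "0 \<le> t"
      then show "0 \<le> l2norm M (neg_part (T t f))" by simp
    next
      fix t \<epsilon> :: real assume t: "0 \<le> t" and e: "0 < \<epsilon>"
      let ?u = "T t f" and ?p = "neg_part (T t f)"
      have "eventually (\<lambda>h. (l2norm M ((T (t + h) f - ?u) - ?p))\<^sup>2 \<le> (l2norm M ?p)\<^sup>2 + \<epsilon> * h) (at_right 0)"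
      proof (rule l2.distance_first_order[where w = "T t w"])
        show "((\<lambda>h. l2norm M ((T (t + h) f - T t f) /\<^sub>R h - T t w)) \<longlongrightarrow> 0) (at_right 0)"
          using lap t by (intro heat.right_derivative) (auto simp: laplacian_iff_gen)
        show "0 \<le> l2inner M (T t w) (neg_part (T t f))"
          using laplacian_heat[OF lap t] by (rule laplacian_neg_part)
      qed (use t e in auto)
      with eventually_at_right_less[of "0::real"]
      show "eventually (\<lambda>h. (l2norm M (neg_part (T (t + h) f)))\<^sup>2 \<le> (l2norm M ?p)\<^sup>2 + \<epsilon> * h) (at_right 0)"
      proof eventually_elim
        case (elim h)
        \<comment> \<open>\<open>?u + ?p\<close> is the positive part of \<open>?u\<close>, and the negative part of a function is at most
          its distance to any nonnegative function.\<close>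
        have "l2norm M (neg_part (T (t + h) f)) \<le> l2norm M ((T (t + h) f - ?u) - ?p)"
          using t elim by (intro l2norm_abs_le AE_I2 L2_measurable) (auto simp: neg_part_apply)
        then have "(l2norm M (neg_part (T (t + h) f)))\<^sup>2 \<le> (l2norm M ((T (t + h) f - ?u) - ?p))\<^sup>2"
          using t elim by (intro power_mono) auto
        then show ?case using elim by simp
      qed
    next
      fix t \<epsilon> :: real assume t: "0 < t" and e: "0 < \<epsilon>"
      have "eventually (\<lambda>s. l2norm M (T s f - T t f) < \<epsilon>) (at_left t)"
        using order_tendstoD(2)[OF heat.left_continuous[of f t] e] t by simp
      with eventually_at_left_real[OF t]
      show "eventually (\<lambda>s. l2norm M (neg_part (T t f)) \<le> l2norm M (neg_part (T s f)) + \<epsilon>) (at_left t)"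
      proof eventually_elim
        case (elim s)
        then show ?case
          using neg_part_lipschitz[of "T t f" M "T s f"] l2.nrm_minus_commute[of "T t f" M "T s f"] t by simp
      qed
    qed
    also have "\<dots> \<le> l2norm M (neg_part f)"
      using neg_part_lipschitz[of "T 0 f" M f] heat.T_0[of f] by simp
    finally show ?thesis .
  qed
  obtain K where K: "0 \<le> K" "\<And>g. g \<in> L2 M \<Longrightarrow> l2norm M (T t g) \<le> K * l2norm M g"
    using l2.bdd_op_bound[OF heat.T_op[OF t]] by blast
  show ?thesis
  proof (rule field_le_epsilon)
    fix e :: real assume e: "e > 0"
    obtain u w where u: "laplacian M D E u w" "l2norm M (f - u) < e / (K + 1)"
      using laplacian_dense_L2[OF f, of "e / (K + 1)"] e K by auto
    define r where "r = l2norm M (f - u)"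
    have uL [simp]: "u \<in> L2 M" using laplacian_D[OF u(1)] by simp
    have "l2norm M (neg_part (T t f)) \<le> l2norm M (neg_part (T t u)) + l2norm M (T t f - T t u)"
      using f t by (intro neg_part_lipschitz) auto
    also have "l2norm M (T t f - T t u) = l2norm M (T t (f - u))"
      using f by (intro l2.bdd_op_nrm_diff heat.T_op t) auto
    also have "\<dots> \<le> K * l2norm M (f - u)" using f by (intro K) auto
    also have "l2norm M (neg_part (T t u)) \<le> l2norm M (neg_part u)" by (rule smooth[OF u(1)])
    also have "l2norm M (neg_part u) \<le> l2norm M (neg_part f) + l2norm M (f - u)"
      using neg_part_lipschitz[of u M f] f l2.nrm_minus_commute[of u M f] by simp
    finally have "l2norm M (neg_part (T t f)) \<le> l2norm M (neg_part f) + (K + 1) * l2norm M (f - u)"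
      unfolding r_def[symmetric] by (simp add: algebra_simps)
    also have "(K + 1) * l2norm M (f - u) \<le> (K + 1) * (e / (K + 1))"
      using u(2) K(1) by (intro mult_left_mono) auto
    finally show "l2norm M (neg_part (T t f)) \<le> l2norm M (neg_part f) + e" using K(1) by simp
  qed
qed

lemma heat_positive:
  assumes f: "f \<in> L2 M" "AE x in M. 0 \<le> f x" and t: "0 \<le> t"
  shows "AE x in M. 0 \<le> T t f x"
proof -
  have "l2norm M (neg_part f) = 0"
    using f by (subst l2norm_eq_0_iff) (auto simp: neg_part_apply elim: eventually_mono)
  then have "l2norm M (neg_part (T t f)) = 0"
    using heat_neg_part_le[OF f(1) t] l2.nrm_nonneg[of "neg_part (T t f)" M] f t
    by (intro antisym) auto
  then have "AE x in M. neg_part (T t f) x = 0"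
    using f t by (subst (asm) l2norm_eq_0_iff) auto
  then show ?thesis by eventually_elim (simp add: neg_part_apply max_def split: if_splits)
qed

lemma heat_mono:
  assumes [simp]: "f \<in> L2 M" "g \<in> L2 M" and le: "AE x in M. f x \<le> g x" and t: "0 \<le> t"
  shows "AE x in M. T t f x \<le> T t g x"
proof -
  have "AE x in M. 0 \<le> T t (g - f) x"
    by (rule heat_positive[OF _ _ t]) (use le in \<open>auto elim: eventually_mono\<close>)
  moreover have "l2norm M (T t (g - f) - (T t g - T t f)) = 0"
    by (rule l2.bdd_op_diff[OF heat.T_op[OF t]]) auto
  then have "AE x in M. T t (g - f) x = (T t g - T t f) x"
    using t by (subst (asm) l2norm_diff_0) auto
  ultimately show ?thesis by eventually_elim simp
qed

lemma heat_cong: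
  assumes "f \<in> L2 M" "g \<in> L2 M" "AE x in M. f x = g x" "0 \<le> t"
  shows "AE x in M. T t f x = T t g x"
proof -
  have "AE x in M. f x \<le> g x" "AE x in M. g x \<le> f x"
    using assms(3) by (auto elim: eventually_mono)
  then have "AE x in M. T t f x \<le> T t g x" "AE x in M. T t g x \<le> T t f x"
    using assms heat_mono by blast+
  then show ?thesis by eventually_elim simp
qed

end

section \<open>The differential\<close>

context dirichlet_form
begin

lemma energy_nrm_le: "f \<in> D \<Longrightarrow> energy.nrm f \<le> E1norm M E f"
  by (simp add: energy.nrm_def E1norm_def)

lemma E1norm_le_sum: "f \<in> D \<Longrightarrow> E1norm M E f \<le> energy.nrm f + l2norm M f"
  by (rule power2_le_imp_le) (simp_all add: E1norm_sq power2_sum energy.nrm_sq)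

text \<open>Closedness of the form, for sequences known to converge in \<open>L\<^sup>2\<close>.\<close>

lemma closed_L2:
  assumes u: "\<And>n. u n \<in> D" and f: "f \<in> L2 M" and lim: "(\<lambda>n. l2norm M (u n - f)) \<longlonglongrightarrow> 0"
    and cau: "\<And>\<epsilon>. \<epsilon> > 0 \<Longrightarrow> \<exists>N. \<forall>m\<ge>N. \<forall>n\<ge>N. energy.nrm (u m - u n) < \<epsilon>"
  shows "f \<in> D" "(\<lambda>n. E1norm M E (u n - f)) \<longlonglongrightarrow> 0"
proof -
  have "\<exists>N. \<forall>m\<ge>N. \<forall>n\<ge>N. E1norm M E (\<lambda>x. u m x - u n x) < \<epsilon>" if e: "\<epsilon> > 0" for \<epsilon>
  proof -
    obtain N1 where N1: "\<And>m n. m \<ge> N1 \<Longrightarrow> n \<ge> N1 \<Longrightarrow> energy.nrm (u m - u n) < \<epsilon> / 3"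
      using cau[of "\<epsilon> / 3"] e by auto
    obtain N2 where N2: "\<And>n. n \<ge> N2 \<Longrightarrow> l2norm M (u n - f) < \<epsilon> / 3"
      using order_tendstoD(2)[OF lim, of "\<epsilon> / 3"] e by (auto simp: eventually_sequentially)
    have "E1norm M E (u m - u n) < \<epsilon>" if "m \<ge> max N1 N2" "n \<ge> max N1 N2" for m n
      using N1[of m n] N2[of m] N2[of n] that E1norm_le_sum[of "u m - u n"]
        l2.nrm_triangle_mid[of "u m" M f "u n"] l2.nrm_minus_commute[of f M "u n"] u f by simp
    then show ?thesis by (intro exI[of _ "max N1 N2"]) (simp add: fun_pointwise)
  qed
  from E_closed[OF u this] obtain v where v: "v \<in> D" "(\<lambda>n. E1norm M E (u n - v)) \<longlonglongrightarrow> 0"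
    by (auto simp: fun_pointwise)
  have lv: "(\<lambda>n. l2norm M (u n - v)) \<longlonglongrightarrow> 0"
  proof (rule Lim_null_comparison[OF always_eventually v(2)])
    show "\<forall>n. norm (l2norm M (u n - v)) \<le> E1norm M E (u n - v)"
      using l2norm_le_E1norm u v by simp
  qed
  have vf0: "l2norm M (v - f) = 0"
    by (rule l2.tendsto_nrm_unique[OF _ _ _ lv lim]) (use u v f in auto)
  then have "AE x in M. v x = f x" using v f by (subst (asm) l2norm_diff_0) auto
  then show fD: "f \<in> D" by (rule D_cong[OF v(1) f])
  have "E1norm M E (v - f) = 0"
    using E_null[of "v - f"] vf0 v fD by (simp add: E1norm_def)
  then have "E1norm M E (u n - f) = E1norm M E (u n - v)" for n
    using e1.nrm_eqI[of "u n - f" "u n - v"] u v fD by simp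
  with v(2) show "(\<lambda>n. E1norm M E (u n - f)) \<longlonglongrightarrow> 0" by simp
qed

end

context one_forms
begin

lemma core_D: "f \<in> core D \<Longrightarrow> f \<in> D"
  by (simp add: core_def)

lemma Cc_core: "f \<in> D \<Longrightarrow> f \<in> Cc \<Longrightarrow> f \<in> core D"
proof -
  assume f: "f \<in> D" "f \<in> Cc"
  then have c: "continuous_on UNIV f" "compact (closure {x. f x \<noteq> 0})" by (auto simp: Cc_def)
  then have "compact (f ` closure {x. f x \<noteq> 0})"
    by (intro compact_continuous_image) (auto intro: continuous_on_subset)
  then have "bounded (insert 0 (f ` closure {x. f x \<noteq> 0}))"
    by (simp add: compact_imp_bounded)
  moreover have "range f \<subseteq> insert 0 (f ` closure {x. f x \<noteq> 0})"
    using closure_subset[of "{x. f x \<noteq> 0}"] by auto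
  ultimately have "bounded (range f)" by (rule bounded_subset)
  then show "f \<in> core D" using f c by (simp add: core_def)
qed

abbreviation tens1 :: "('a \<Rightarrow> real) \<Rightarrow> 'h" where
  "tens1 f \<equiv> tens f (\<lambda>_. 1)"

lemma tens1_inner:
  assumes "f \<in> core D" "g \<in> core D"
  shows "tens1 f \<bullet> tens1 g = E f g"
proof -
  have "(\<lambda>_. 1) \<in> Bb" by (auto simp: Bb_def)
  then have "tens1 f \<bullet> tens1 g = (\<integral>x. 1 * 1 * \<Gamma> f g x \<partial>M)"
    using assms by (intro tens_inner)
  then show ?thesis using assms by (simp add: \<Gamma>_energy core_D)
qed

lemma norm_tens1_diff:
  assumes "f \<in> core D" "g \<in> core D"
  shows "norm (tens1 f - tens1 g) = energy.nrm (f - g)"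
proof -
  have "(tens1 f - tens1 g) \<bullet> (tens1 f - tens1 g) = E (f - g) (f - g)"
    using assms by (simp add: inner_diff_left inner_diff_right tens1_inner energy.ip_simps core_D)
  then show ?thesis by (simp add: norm_eq_sqrt_inner energy.nrm_def)
qed

lemma core_dense:
  assumes f: "f \<in> D"
  obtains u where "\<And>n. u n \<in> core D" "(\<lambda>n. E1norm M E (u n - f)) \<longlonglongrightarrow> 0"
proof -
  have "\<exists>g \<in> core D. E1norm M E (g - f) < inverse (real (Suc n))" for n
  proof -
    obtain g where "g \<in> D \<inter> Cc" "E1norm M E (f - g) < inverse (real (Suc n))"
      using regular_D[OF f, of "inverse (real (Suc n))"] by (auto simp: fun_pointwise)
    then show ?thesis using Cc_core e1.nrm_minus_commute[of f g] f by auto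
  qed
  then obtain u where u: "\<And>n. u n \<in> core D" "\<And>n. E1norm M E (u n - f) < inverse (real (Suc n))"
    by metis
  have "(\<lambda>n. E1norm M E (u n - f)) \<longlonglongrightarrow> 0"
  proof (rule Lim_null_comparison[OF always_eventually LIMSEQ_inverse_real_of_nat])
    show "\<forall>n. norm (E1norm M E (u n - f)) \<le> inverse (real (Suc n))"
      using u e1.nrm_nonneg[of "u _ - f"] f core_D by (auto intro: less_imp_le)
  qed
  with u that show thesis by blast
qed

lemma tendsto_energy_nrm:
  assumes "\<And>n. u n \<in> D" "f \<in> D" "(\<lambda>n. E1norm M E (u n - f)) \<longlonglongrightarrow> 0"
  shows "(\<lambda>n. energy.nrm (u n - f)) \<longlonglongrightarrow> 0"
proof (rule Lim_null_comparison[OF always_eventually assms(3)])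
  show "\<forall>n. norm (energy.nrm (u n - f)) \<le> E1norm M E (u n - f)"
    using energy_nrm_le assms by simp
qed

lemma Cauchy_tens1:
  assumes u: "\<And>n. u n \<in> core D" and f: "f \<in> D" and lim: "(\<lambda>n. E1norm M E (u n - f)) \<longlonglongrightarrow> 0"
  shows "convergent (\<lambda>n. tens1 (u n))"
proof -
  have uD: "u n \<in> D" for n using u core_D by blast
  have "Cauchy (\<lambda>n. tens1 (u n))"
  proof (rule metric_CauchyI)
    fix e :: real assume "e > 0"
    then obtain N where N: "\<And>n. n \<ge> N \<Longrightarrow> energy.nrm (u n - f) < e / 2"
      using order_tendstoD(2)[OF tendsto_energy_nrm[OF uD f lim], of "e / 2"]
      by (auto simp: eventually_sequentially)
    have "dist (tens1 (u m)) (tens1 (u n)) < e" if "m \<ge> N" "n \<ge> N" for m n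
      using N[OF that(1)] N[OF that(2)] energy.nrm_triangle_mid[of "u m" f "u n"] uD f
        energy.nrm_minus_commute[of f "u n"]
      by (simp add: dist_norm norm_tens1_diff u)
    then show "\<exists>N. \<forall>m\<ge>N. \<forall>n\<ge>N. dist (tens1 (u m)) (tens1 (u n)) < e" by blast
  qed
  then show ?thesis by (rule Cauchy_convergent)
qed

text \<open>
  The definite description in \<open>dform\<close> is justified by closability: by \<open>closed_L2\<close>, a sequence in the core
  that converges to \<open>f\<close> in \<open>L\<^sup>2\<close> and along which \<open>u \<otimes> 1\<close> converges also converges in the norm of the form.
\<close>

lemma dform_tendsto:
  assumes f: "f \<in> D" and u: "\<And>n. u n \<in> core D" and lim: "(\<lambda>n. E1norm M E (u n - f)) \<longlonglongrightarrow> 0"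
  shows "(\<lambda>n. tens1 (u n)) \<longlonglongrightarrow> dform M D tens f"
proof -
  have uD: "u n \<in> D" for n using u core_D by blast
  obtain \<eta> where \<eta>: "(\<lambda>n. tens1 (u n)) \<longlonglongrightarrow> \<eta>"
    using Cauchy_tens1[OF u f lim] by (auto simp: convergent_def)
  have "dform M D tens f = \<eta>"
    unfolding dform_def
  proof (rule the_equality)
    have "(\<lambda>n. l2norm M (u n - f)) \<longlonglongrightarrow> 0"
    proof (rule Lim_null_comparison[OF always_eventually lim])
      show "\<forall>n. norm (l2norm M (u n - f)) \<le> E1norm M E (u n - f)"
        using l2norm_le_E1norm uD f by simp
    qed
    then show "\<exists>u. (\<forall>n. u n \<in> core D) \<and> (\<lambda>n. l2norm M (\<lambda>x. u n x - f x)) \<longlonglongrightarrow> 0 \<and>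
        (\<lambda>n. tens1 (u n)) \<longlonglongrightarrow> \<eta>"
      using u \<eta> by (intro exI[of _ u]) (simp add: fun_pointwise)
  next
    fix \<eta>' assume "\<exists>u. (\<forall>n. u n \<in> core D) \<and> (\<lambda>n. l2norm M (\<lambda>x. u n x - f x)) \<longlonglongrightarrow> 0 \<and>
        (\<lambda>n. tens1 (u n)) \<longlonglongrightarrow> \<eta>'"
    then obtain v where v: "\<And>n. v n \<in> core D" "(\<lambda>n. l2norm M (v n - f)) \<longlonglongrightarrow> 0"
      "(\<lambda>n. tens1 (v n)) \<longlonglongrightarrow> \<eta>'"
      by (auto simp: fun_pointwise)
    have vD: "v n \<in> D" for n using v core_D by blast
    have "\<exists>N. \<forall>m\<ge>N. \<forall>n\<ge>N. energy.nrm (v m - v n) < \<epsilon>" if "\<epsilon> > 0" for \<epsilon>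
      using metric_CauchyD[OF LIMSEQ_imp_Cauchy[OF v(3)] that] by (simp add: dist_norm norm_tens1_diff v)
    then have limv: "(\<lambda>n. E1norm M E (v n - f)) \<longlonglongrightarrow> 0"
      using f by (intro closed_L2(2)[OF vD _ v(2)]) auto
    have "(\<lambda>n. energy.nrm (u n - f) + energy.nrm (v n - f)) \<longlonglongrightarrow> 0 + 0"
      by (intro tendsto_add tendsto_energy_nrm uD vD f lim limv)
    then have sum0: "(\<lambda>n. energy.nrm (u n - f) + energy.nrm (v n - f)) \<longlonglongrightarrow> 0" by simp
    have "(\<lambda>n. tens1 (v n) - tens1 (u n)) \<longlonglongrightarrow> 0"
    proof (rule Lim_null_comparison[OF always_eventually sum0], intro allI)
      fix n
      show "norm (tens1 (v n) - tens1 (u n)) \<le> energy.nrm (u n - f) + energy.nrm (v n - f)"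
        using energy.nrm_triangle_mid[of "v n" f "u n"] energy.nrm_minus_commute[of f "u n"] uD vD f
        by (simp add: norm_tens1_diff u v)
    qed
    moreover have "(\<lambda>n. tens1 (v n) - tens1 (u n)) \<longlonglongrightarrow> \<eta>' - \<eta>" by (intro tendsto_diff v \<eta>)
    ultimately show "\<eta>' = \<eta>" using LIMSEQ_unique by fastforce
  qed
  with \<eta> show ?thesis by simp
qed

abbreviation grad :: "('a \<Rightarrow> real) \<Rightarrow> 'h" where
  "grad \<equiv> dform M D tens"

lemma dform_inner:
  assumes f: "f \<in> D" and g: "g \<in> D"
  shows "grad f \<bullet> grad g = E f g"
proof -
  have half: "grad f \<bullet> tens1 w = E f w" if f: "f \<in> D" and w: "w \<in> core D" for f w
  proof -
    obtain u where u: "\<And>n. u n \<in> core D" "(\<lambda>n. E1norm M E (u n - f)) \<longlonglongrightarrow> 0"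
      using core_dense[OF f] by blast
    have uD: "u n \<in> D" for n using u core_D by blast
    have "(\<lambda>n. tens1 (u n) \<bullet> tens1 w) \<longlonglongrightarrow> grad f \<bullet> tens1 w"
      by (intro tendsto_intros dform_tendsto[OF f u])
    moreover have "(\<lambda>n. E (u n) w) \<longlonglongrightarrow> E f w"
      by (intro energy.tendsto_ip uD f core_D w tendsto_energy_nrm u)
    ultimately show ?thesis using LIMSEQ_unique by (simp add: tens1_inner u w)
  qed
  obtain v where v: "\<And>n. v n \<in> core D" "(\<lambda>n. E1norm M E (v n - g)) \<longlonglongrightarrow> 0"
    using core_dense[OF g] by blast
  have vD: "v n \<in> D" for n using v core_D by blast
  have "(\<lambda>n. grad f \<bullet> tens1 (v n)) \<longlonglongrightarrow> grad f \<bullet> grad g"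
    by (intro tendsto_intros dform_tendsto[OF g v])
  moreover have "(\<lambda>n. E (v n) f) \<longlonglongrightarrow> E g f"
    by (intro energy.tendsto_ip vD f g tendsto_energy_nrm v)
  moreover have "grad f \<bullet> tens1 (v n) = E (v n) f" for n
    using half[OF f v(1)] E_sym[OF f vD] by simp
  ultimately show ?thesis using LIMSEQ_unique E_sym[OF f g] by simp
qed

lemma norm_dform: "f \<in> D \<Longrightarrow> norm (grad f) = energy.nrm f"
  by (simp add: norm_eq_sqrt_inner energy.nrm_def dform_inner)

lemma dform_diff:
  assumes "f \<in> D" "g \<in> D"
  shows "grad (f - g) = grad f - grad g"
proof -
  have "(grad (f - g) - (grad f - grad g)) \<bullet> (grad (f - g) - (grad f - grad g)) = 0"
    using assms by (simp add: inner_diff_left inner_diff_right dform_inner energy.ip_simps)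
  then show ?thesis by simp
qed

lemma dform_scale:
  assumes "f \<in> D"
  shows "grad (c *\<^sub>R f) = c *\<^sub>R grad f"
proof -
  have "(grad (c *\<^sub>R f) - c *\<^sub>R grad f) \<bullet> (grad (c *\<^sub>R f) - c *\<^sub>R grad f) = 0"
    using assms by (simp add: inner_diff_left inner_diff_right dform_inner energy.ip_simps)
  then show ?thesis by simp
qed

lemma dform_core:
  assumes f: "f \<in> core D"
  shows "grad f = tens1 f"
proof -
  have "(\<lambda>n::nat. tens1 f) \<longlonglongrightarrow> grad f"
    by (rule dform_tendsto) (use f core_D in auto)
  from LIMSEQ_unique[OF this tendsto_const] show ?thesis .
qed

lemma dform_closed:
  assumes u: "\<And>n. u n \<in> D" and f: "f \<in> L2 M" and lim: "(\<lambda>n. l2norm M (u n - f)) \<longlonglongrightarrow> 0"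
    and \<eta>: "(\<lambda>n. grad (u n)) \<longlonglongrightarrow> \<eta>"
  shows "f \<in> D" "grad f = \<eta>"
proof -
  have "\<exists>N. \<forall>m\<ge>N. \<forall>n\<ge>N. energy.nrm (u m - u n) < \<epsilon>" if "\<epsilon> > 0" for \<epsilon>
    using metric_CauchyD[OF LIMSEQ_imp_Cauchy[OF \<eta>] that]
    by (simp add: dist_norm u norm_dform flip: dform_diff)
  note cl = closed_L2[OF u f lim this]
  show fD: "f \<in> D" by (rule cl(1))
  have "(\<lambda>n. norm (grad (u n) - grad f)) \<longlonglongrightarrow> 0"
    using tendsto_energy_nrm[OF u fD cl(2)] by (simp add: u fD norm_dform flip: dform_diff)
  then have "(\<lambda>n. grad (u n)) \<longlonglongrightarrow> grad f"
    by (simp add: tendsto_norm_zero_iff flip: LIM_zero_iff[of _ "grad f"])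
  with \<eta> show "grad f = \<eta>" by (rule LIMSEQ_unique[symmetric])
qed

lemma form_laplacian_dform:
  assumes u: "laplacian M D E u w" and w: "w \<in> D"
  shows "form_laplacian M D tens (grad u) (grad w)"
proof -
  have "codiff M D tens (grad u) (- w)"
    unfolding codiff_def
  proof (intro conjI ballI)
    show "- w \<in> L2 M" by (rule l2.V_closed(5)[OF D_in_L2[OF w]])
    fix f assume f: "f \<in> D"
    have "grad f \<bullet> grad u = E u f"
      using dform_inner[OF f laplacian_D[OF u]] E_sym[OF f laplacian_D[OF u]] by simp
    also have "\<dots> = - l2inner M f w" by (rule laplacian_E[OF u f])
    finally show "grad f \<bullet> grad u = l2inner M f (- w)" using f w by (simp add: l2.ip_minus_right)
  qed
  moreover have "grad w = - grad (- w)" using dform_scale[OF w, of "-1"] by simp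
  ultimately show ?thesis unfolding form_laplacian_def using w by (intro exI[of _ "- w"]) auto
qed

lemma form_laplacian_diff:
  assumes "form_laplacian M D tens \<eta> \<zeta>" "form_laplacian M D tens \<eta>' \<zeta>'"
  shows "form_laplacian M D tens (\<eta> - \<eta>') (\<zeta> - \<zeta>')"
proof -
  obtain w w' where w: "codiff M D tens \<eta> w" "w \<in> D" "\<zeta> = - grad w"
    "codiff M D tens \<eta>' w'" "w' \<in> D" "\<zeta>' = - grad w'"
    using assms unfolding form_laplacian_def by blast
  have "codiff M D tens (\<eta> - \<eta>') (w - w')"
    using w unfolding codiff_def by (auto simp: inner_diff_right l2.ip_simps)
  then show ?thesis
    unfolding form_laplacian_def using w by (intro exI[of _ "w - w'"]) (simp add: dform_diff)
qed

lemma form_laplacian_dissipative: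
  assumes "form_laplacian M D tens \<eta> \<zeta>"
  shows "\<zeta> \<bullet> \<eta> \<le> 0"
proof -
  obtain w where w: "codiff M D tens \<eta> w" "w \<in> D" "\<zeta> = - grad w"
    using assms unfolding form_laplacian_def by blast
  then have "grad w \<bullet> \<eta> = l2inner M w w" by (simp add: codiff_def)
  then show ?thesis using w l2.ip_nonneg[of w M] by simp
qed

end

section \<open>Intertwining of the two semigroups\<close>

lemma inner_semi_hilbert:
  "semi_hilbert UNIV (inner :: 'h::{real_inner, complete_space} \<Rightarrow> 'h \<Rightarrow> real)"
  and inner_nrm: "semi_inner.nrm (inner :: 'h \<Rightarrow> 'h \<Rightarrow> real) = norm"
proof -
  interpret i: semi_inner UNIV "inner :: 'h \<Rightarrow> 'h \<Rightarrow> real"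
  proof
    show "x \<bullet> y = y \<bullet> x" for x y :: 'h by (rule inner_commute)
  qed (simp_all add: inner_add_left)
  show eq: "semi_inner.nrm (inner :: 'h \<Rightarrow> 'h \<Rightarrow> real) = norm"
    by (rule ext) (simp add: i.nrm_def norm_eq_sqrt_inner)
  show "semi_hilbert UNIV (inner :: 'h \<Rightarrow> 'h \<Rightarrow> real)"
  proof (unfold_locales, unfold eq)
    fix u :: "nat \<Rightarrow> 'h" assume inc: "\<And>n. norm (u (Suc n) - u n) \<le> (1/2) ^ n"
    have "Cauchy u"
    proof (rule metric_CauchyI)
      fix e :: real assume "e > 0"
      then obtain N where N: "(1/2::real) ^ N < e / 4"
        using real_arch_pow_inv[of "e / 4" "1/2"] by auto
      have "dist (u m) (u n) < e" if "m \<ge> N" "n \<ge> N" for m n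
        using i.geometric_increments[of u "1/2" N m, unfolded eq]
          i.geometric_increments[of u "1/2" N n, unfolded eq] inc that N
          dist_triangle2[of "u m" "u n" "u N"] by (simp add: dist_norm)
      then show "\<exists>N. \<forall>m\<ge>N. \<forall>n\<ge>N. dist (u m) (u n) < e" by blast
    qed
    then obtain v where "u \<longlonglongrightarrow> v" using Cauchy_convergent by (auto simp: convergent_def)
    then have "(\<lambda>n. norm (u n - v)) \<longlonglongrightarrow> 0"
      by (simp add: LIM_zero tendsto_norm_zero)
    then show "\<exists>v\<in>UNIV. (\<lambda>n. norm (u n - v)) \<longlonglongrightarrow> 0" by blast
  qed
qed

lemma c0_semigroup_imp_c0_sg:
  fixes S :: "real \<Rightarrow> 'h::{real_inner, complete_space} \<Rightarrow> 'h"
  assumes S: "c0_semigroup A S"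
  shows "c0_sg UNIV inner S"
proof -
  interpret i: semi_hilbert UNIV "inner :: 'h \<Rightarrow> 'h \<Rightarrow> real"
    by (rule inner_semi_hilbert)
  show ?thesis
  proof (unfold_locales, unfold inner_nrm)
    fix t :: real assume "0 \<le> t"
    then interpret bounded_linear "S t" using S by (simp add: c0_semigroup_def)
    show "semi_inner.bdd_op UNIV inner (S t)"
      unfolding i.bdd_op_def inner_nrm using nonneg_bounded by (auto simp: add scale mult.commute)
  next
    fix x
    have "((\<lambda>t. S t x) \<longlongrightarrow> x) (at_right 0)" using S by (simp add: c0_semigroup_def)
    then show "((\<lambda>t. norm (S t x - x)) \<longlongrightarrow> 0) (at_right 0)"
      by (intro tendsto_norm_zero LIM_zero)
  qed (use S in \<open>auto simp: c0_semigroup_def\<close>)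
qed

text \<open>The heat semigroups on functions and on one-forms.\<close>

locale one_forms_heat = one_forms M D E \<Gamma> tens + heat_flow M D E T
  for M :: "'a::{metric_space, second_countable_topology} measure" and D E \<Gamma>
    and tens :: "('a \<Rightarrow> real) \<Rightarrow> ('a \<Rightarrow> real) \<Rightarrow> 'h::{real_inner, complete_space}" and T +
  fixes S :: "real \<Rightarrow> 'h \<Rightarrow> 'h"
  assumes form_heat: "c0_semigroup (form_laplacian M D tens) S"
begin

sublocale fh: c0_sg UNIV inner S
  rewrites "semi_inner.nrm (inner :: 'h \<Rightarrow> 'h \<Rightarrow> real) = norm"
  by (rule c0_semigroup_imp_c0_sg[OF form_heat]) (rule inner_nrm)

lemma form_laplacian_iff_gen: "form_laplacian M D tens \<eta> \<zeta> \<longleftrightarrow> fh.gen \<eta> \<zeta>"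
proof -
  have "form_laplacian M D tens \<eta> \<zeta> \<longleftrightarrow> ((\<lambda>t. (S t \<eta> - \<eta>) /\<^sub>R t) \<longlongrightarrow> \<zeta>) (at_right 0)"
    using form_heat unfolding c0_semigroup_def by blast
  also have "\<dots> \<longleftrightarrow> fh.gen \<eta> \<zeta>"
    unfolding fh.gen_def by (simp add: tendsto_norm_zero_iff LIM_zero_iff)
  finally show ?thesis .
qed

text \<open>Convergence in the graph norm of \<open>\<Delta>\<close> implies convergence of differentials.\<close>

lemma norm_dform_laplacian_le:
  assumes "laplacian M D E q r"
  shows "norm (grad q) \<le> sqrt (l2norm M q * l2norm M r)"
proof -
  have q: "q \<in> D" "r \<in> L2 M" using assms by (auto simp: laplacian_def)
  have "E q q = - l2inner M q r" by (rule laplacian_E[OF assms q(1)])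
  also have "\<dots> \<le> l2norm M q * l2norm M r" using l2.Cauchy_Schwarz[of q M r] q by simp
  finally show ?thesis using q by (simp add: norm_dform energy.nrm_def)
qed

text \<open>
  For initial data in the domain of \<open>\<Delta>\<^sup>2\<close> both sides are solutions of the heat equation for
  one-forms, so the norm of their difference does not increase.
\<close>

lemma intertwining_smooth:
  assumes f: "laplacian M D E f w" and w: "laplacian M D E w z" and t: "0 \<le> t"
  shows "grad (T t f) = S t (grad f)"
proof -
  have [simp]: "f \<in> D" "w \<in> D" "z \<in> L2 M" using f w by (auto simp: laplacian_def)
  have TD [simp]: "T t f \<in> D" "T t w \<in> D" if "0 \<le> t" for t
    using laplacian_heat[OF f that] laplacian_heat[OF w that] by (auto simp: laplacian_def)
  define \<zeta> where "\<zeta> = (\<lambda>t. grad (T t f) - S t (grad f))"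
  define \<xi> where "\<xi> = (\<lambda>t. grad (T t w) - S t (grad w))"
  have gen0: "form_laplacian M D tens (grad f) (grad w)"
    by (rule form_laplacian_dform[OF f]) simp
  have gen: "form_laplacian M D tens (\<zeta> t) (\<xi> t)" if "0 \<le> t" for t
    unfolding \<zeta>_def \<xi>_def
  proof (rule form_laplacian_diff)
    show "form_laplacian M D tens (grad (T t f)) (grad (T t w))"
      using that by (intro form_laplacian_dform laplacian_heat f) auto
    show "form_laplacian M D tens (S t (grad f)) (S t (grad w))"
      using gen0 fh.gen_invariant[OF _ that] by (simp add: form_laplacian_iff_gen)
  qed
  have "norm (\<zeta> t) \<le> norm (\<zeta> 0)"
  proof (rule one_sided_nonincreasing[OF _ _ _ t])
    fix t \<epsilon> :: real assume t: "0 \<le> t" and e: "0 < \<epsilon>"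
    define q where "q = (\<lambda>h. (T (t + h) f - T t f) /\<^sub>R h - T t w)"
    define r where "r = (\<lambda>h. (T (t + h) w - T t w) /\<^sub>R h - T t z)"
    define y where "y = (\<lambda>h. (S (t + h) (grad f) - S t (grad f)) /\<^sub>R h - S t (grad w))"
    have "((\<lambda>h. sqrt (l2norm M (q h) * l2norm M (r h)) + norm (y h)) \<longlongrightarrow> sqrt (0 * 0) + 0) (at_right 0)"
      unfolding q_def r_def y_def using f w gen0
      by (intro tendsto_intros heat.right_derivative fh.right_derivative t)
         (auto simp: laplacian_iff_gen form_laplacian_iff_gen)
    then have lim: "((\<lambda>h. sqrt (l2norm M (q h) * l2norm M (r h)) + norm (y h)) \<longlongrightarrow> 0) (at_right 0)"
      by simp
    have "((\<lambda>h. norm ((\<zeta> (t + h) - \<zeta> t) /\<^sub>R h - \<xi> t)) \<longlongrightarrow> 0) (at_right 0)"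
    proof (rule Lim_null_comparison[OF _ lim])
      show "eventually (\<lambda>h. norm (norm ((\<zeta> (t + h) - \<zeta> t) /\<^sub>R h - \<xi> t)) \<le>
          sqrt (l2norm M (q h) * l2norm M (r h)) + norm (y h)) (at_right 0)"
        using eventually_at_right_less[of "0::real"]
      proof eventually_elim
        case (elim h)
        have "laplacian M D E (q h) (r h)"
          unfolding q_def r_def using t elim
          by (intro laplacian_diff laplacian_scale laplacian_heat f w) auto
        then have "norm (grad (q h)) \<le> sqrt (l2norm M (q h) * l2norm M (r h))"
          by (rule norm_dform_laplacian_le)
        moreover have "grad (q h) = (grad (T (t + h) f) - grad (T t f)) /\<^sub>R h - grad (T t w)"
          unfolding q_def using t elim by (simp add: dform_diff dform_scale)
        then have "(\<zeta> (t + h) - \<zeta> t) /\<^sub>R h - \<xi> t = grad (q h) - y h"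
          by (simp add: \<zeta>_def \<xi>_def y_def algebra_simps)
        ultimately show ?case using norm_triangle_ineq4[of "grad (q h)" "y h"] by simp
      qed
    qed
    then have "eventually (\<lambda>h. (norm ((\<zeta> (t + h) - \<zeta> t) - (- \<zeta> t)))\<^sup>2 \<le> (norm (- \<zeta> t))\<^sup>2 + \<epsilon> * h) (at_right 0)"
      using form_laplacian_dissipative[OF gen[OF t]] e by (intro fh.distance_first_order[of _ _ "\<xi> t"]) auto
    then show "eventually (\<lambda>h. (norm (\<zeta> (t + h)))\<^sup>2 \<le> (norm (\<zeta> t))\<^sup>2 + \<epsilon> * h) (at_right 0)" by simp
  next
    fix t \<epsilon> :: real assume t: "0 < t" and e: "0 < \<epsilon>"
    have "((\<lambda>s. sqrt (l2norm M (T s f - T t f) * l2norm M (T s w - T t w)) +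
        norm (S s (grad f) - S t (grad f))) \<longlongrightarrow> sqrt (0 * 0) + 0) (at_left t)"
      by (intro tendsto_intros heat.left_continuous fh.left_continuous t) auto
    then have "eventually (\<lambda>s. sqrt (l2norm M (T s f - T t f) * l2norm M (T s w - T t w)) +
        norm (S s (grad f) - S t (grad f)) < \<epsilon>) (at_left t)"
      using e by (auto intro: order_tendstoD(2))
    with eventually_at_left_real[OF t]
    show "eventually (\<lambda>s. norm (\<zeta> t) \<le> norm (\<zeta> s) + \<epsilon>) (at_left t)"
    proof eventually_elim
      case (elim s)
      have "norm (grad (T s f - T t f)) \<le> sqrt (l2norm M (T s f - T t f) * l2norm M (T s w - T t w))"
        using t elim by (intro norm_dform_laplacian_le laplacian_diff laplacian_heat f w) auto
      moreover have "\<zeta> s - \<zeta> t = grad (T s f - T t f) - (S s (grad f) - S t (grad f))"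
        using t elim by (simp add: \<zeta>_def dform_diff)
      then have "norm (\<zeta> s - \<zeta> t) \<le> norm (grad (T s f - T t f)) + norm (S s (grad f) - S t (grad f))"
        by (simp add: norm_triangle_ineq4)
      ultimately show ?case using elim norm_triangle_sub[of "\<zeta> t" "\<zeta> s"] norm_minus_commute[of "\<zeta> s" "\<zeta> t"]
        by simp
    qed
  qed auto
  also have "\<zeta> 0 = 0"
  proof -
    have "l2norm M (T 0 f - f) = 0" by (rule heat.T_0) simp
    then have "norm (grad (T 0 f - f)) = 0"
      using E_null[of "T 0 f - f"] by (simp add: norm_dform energy.nrm_def)
    then show ?thesis using fh.T_0[of "grad f"] by (simp add: \<zeta>_def dform_diff)
  qed
  finally show ?thesis by (simp add: \<zeta>_def)
qed

text \<open>The general case, by density and since \<open>\<partial>\<close> is closed.\<close>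

lemma intertwining:
  assumes f: "f \<in> D" and t: "0 \<le> t"
  shows "T t f \<in> D" "grad (T t f) = S t (grad f)"
proof -
  obtain u w z where u: "\<And>n. laplacian M D E (u n) (w n)" "\<And>n. laplacian M D E (w n) (z n)"
    and lim: "(\<lambda>n. E1norm M E (u n - f)) \<longlonglongrightarrow> 0"
    using laplacian_squared_dense_E1[OF f] by metis
  have uD: "u n \<in> D" for n using u(1) by (rule laplacian_D)
  have TuD: "T t (u n) \<in> D" for n using laplacian_heat[OF u(1) t] by (rule laplacian_D)
  obtain K where K: "0 \<le> K" "\<And>g. g \<in> L2 M \<Longrightarrow> l2norm M (T t g) \<le> K * l2norm M g"
    using l2.bdd_op_bound[OF heat.T_op[OF t]] by blast
  have T_lim: "(\<lambda>n. l2norm M (T t (u n) - T t f)) \<longlonglongrightarrow> 0"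
  proof (rule Lim_null_comparison[OF always_eventually])
    show "(\<lambda>n. K * E1norm M E (u n - f)) \<longlonglongrightarrow> 0" by (rule tendsto_mult_right_zero[OF lim])
    show "\<forall>n. norm (l2norm M (T t (u n) - T t f)) \<le> K * E1norm M E (u n - f)"
    proof
      fix n
      have "l2norm M (T t (u n) - T t f) = l2norm M (T t (u n - f))"
        using uD f by (intro l2.bdd_op_nrm_diff heat.T_op t) auto
      also have "\<dots> \<le> K * l2norm M (u n - f)" using uD f by (intro K) auto
      also have "\<dots> \<le> K * E1norm M E (u n - f)"
        using uD f K by (intro mult_left_mono l2norm_le_E1norm) auto
      finally show "norm (l2norm M (T t (u n) - T t f)) \<le> K * E1norm M E (u n - f)"
        using TuD f t by simp
    qed
  qed
  have "(\<lambda>n. norm (grad (u n) - grad f)) \<longlonglongrightarrow> 0"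
    using tendsto_energy_nrm[OF uD f lim] by (simp add: uD f norm_dform flip: dform_diff)
  then have "(\<lambda>n. grad (u n)) \<longlonglongrightarrow> grad f"
    by (simp add: tendsto_norm_zero_iff flip: LIM_zero_iff[of _ "grad f"])
  moreover have "bounded_linear (S t)" using form_heat t by (simp add: c0_semigroup_def)
  ultimately have "(\<lambda>n. S t (grad (u n))) \<longlonglongrightarrow> S t (grad f)" by (rule bounded_linear.tendsto[rotated])
  then have "(\<lambda>n. grad (T t (u n))) \<longlonglongrightarrow> S t (grad f)"
    using intertwining_smooth[OF u t] by simp
  from dform_closed[OF TuD _ T_lim this] f t
  show "T t f \<in> D" "grad (T t f) = S t (grad f)" by auto
qed

end

section \<open>Fibre norms of gradients\<close>

text \<open>
  Let \<open>b\<close>, \<open>p\<close>, \<open>a\<close> be the values \<open>q(f,f)\<close>, \<open>q(a,f)\<close>, \<open>q(a,a)\<close> of a bilinear form \<open>q\<close>. Nonnegativity at \<open>f \<plusminus> c a\<close>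
  bounds \<open>q(f + a) - q(f)\<close>. A fixed weight \<open>c\<close> replaces the Cauchy-Schwarz inequality, which for
  \<open>\<Gamma>\<close> would require an almost everywhere statement for all \<open>c\<close> at once.
\<close>

lemma quadratic_perturbation:
  fixes a b p c :: real
  assumes c: "c > 0" and minus: "0 \<le> b - 2 * c * p + c\<^sup>2 * a" and plus: "0 \<le> b + 2 * c * p + c\<^sup>2 * a"
    and a: "0 \<le> a"
  shows "\<bar>(b + 2 * p + a) - b\<bar> \<le> (1 + c) * a + b / c"
proof -
  have "c * \<bar>2 * p\<bar> \<le> c * (c * a + b / c)"
  proof -
    have "c * \<bar>2 * p\<bar> = \<bar>2 * c * p\<bar>" using c by (simp add: abs_mult)
    also have "\<dots> \<le> b + c\<^sup>2 * a" using minus plus by (auto simp: abs_if)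
    also have "\<dots> = c * (c * a + b / c)" using c by (simp add: field_simps power2_eq_square)
    finally show ?thesis .
  qed
  then have "\<bar>2 * p\<bar> \<le> c * a + b / c" using c by simp
  then show ?thesis using a by (simp add: algebra_simps)
qed

context carre_du_champ
begin

lemma \<Gamma>_quadratic:
  assumes a: "a \<in> D" and f: "f \<in> D"
  shows "AE x in M. \<Gamma> (f + s *\<^sub>R a) (f + s *\<^sub>R a) x = \<Gamma> f f x + 2 * s * \<Gamma> a f x + s\<^sup>2 * \<Gamma> a a x"
proof -
  have add: "AE x in M. \<Gamma> (g + s *\<^sub>R a) h x = \<Gamma> g h x + s * \<Gamma> a h x" if "g \<in> D" "h \<in> D" for g h
  proof -
    have "s *\<^sub>R a \<in> D" using a by auto
    then have "AE x in M. \<Gamma> (g + s *\<^sub>R a) h x = \<Gamma> g h x + \<Gamma> (s *\<^sub>R a) h x"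
      using \<Gamma>_add[of g "s *\<^sub>R a" h] that by (simp add: fun_pointwise)
    moreover have "AE x in M. \<Gamma> (s *\<^sub>R a) h x = s * \<Gamma> a h x"
      using \<Gamma>_scale[of a h s] a that by (simp add: fun_pointwise)
    ultimately show ?thesis by eventually_elim simp
  qed
  have h: "f + s *\<^sub>R a \<in> D" using a f by auto
  from add[OF f h] \<Gamma>_sym[OF f h] \<Gamma>_sym[OF a h] add[OF f f] add[OF f a] \<Gamma>_sym[OF f a]
  show ?thesis
  proof eventually_elim
    case (elim x)
    then show ?case by (simp add: algebra_simps power2_eq_square)
  qed
qed

lemma \<Gamma>_perturbation:
  assumes u: "u \<in> D" and f: "f \<in> D" and c: "c > 0"
  shows "AE x in M. \<bar>\<Gamma> u u x - \<Gamma> f f x\<bar> \<le> (1 + c) * \<Gamma> (u - f) (u - f) x + \<Gamma> f f x / c"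
proof -
  define a where "a = u - f"
  have a: "a \<in> D" using u f by (auto simp: a_def)
  have pos: "AE x in M. 0 \<le> \<Gamma> (f + s *\<^sub>R a) (f + s *\<^sub>R a) x" for s
    using a f by (intro \<Gamma>_nonneg) auto
  have u_eq: "u = f + 1 *\<^sub>R a" by (simp add: a_def)
  have "AE x in M. \<Gamma> u u x = \<Gamma> f f x + 2 * 1 * \<Gamma> a f x + 1\<^sup>2 * \<Gamma> a a x"
    using \<Gamma>_quadratic[OF a f, of 1] unfolding u_eq[symmetric] .
  with \<Gamma>_quadratic[OF a f, of c] \<Gamma>_quadratic[OF a f, of "- c"] pos[of c] pos[of "- c"] \<Gamma>_nonneg[OF a]
  have "AE x in M. \<bar>\<Gamma> u u x - \<Gamma> f f x\<bar> \<le> (1 + c) * \<Gamma> a a x + \<Gamma> f f x / c"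
  proof eventually_elim
    case (elim x)
    then show ?case
      using quadratic_perturbation[of c "\<Gamma> f f x" "\<Gamma> a f x" "\<Gamma> a a x"] c by simp
  qed
  then show ?thesis by (simp only: a_def)
qed

end

lemma norm_sq_perturbation:
  fixes x y :: "'v::real_inner"
  assumes c: "c > 0"
  shows "\<bar>(norm x)\<^sup>2 - (norm y)\<^sup>2\<bar> \<le> (1 + c) * (norm (x - y))\<^sup>2 + (norm y)\<^sup>2 / c"
proof -
  define a where "a = x - y"
  have q: "(norm (y + s *\<^sub>R a))\<^sup>2 = (norm y)\<^sup>2 + 2 * s * (a \<bullet> y) + s\<^sup>2 * (norm a)\<^sup>2" for s
    by (simp add: power2_norm_eq_inner inner_add_left inner_add_right inner_commute[of y a])
       (simp add: power2_eq_square algebra_simps)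
  have q0: "0 \<le> (norm y)\<^sup>2 + 2 * s * (a \<bullet> y) + s\<^sup>2 * (norm a)\<^sup>2" for s
    unfolding q[symmetric] by simp
  have "\<bar>((norm y)\<^sup>2 + 2 * (a \<bullet> y) + (norm a)\<^sup>2) - (norm y)\<^sup>2\<bar> \<le> (1 + c) * (norm a)\<^sup>2 + (norm y)\<^sup>2 / c"
    by (rule quadratic_perturbation[OF c]) (use q0[of c] q0[of "- c"] in simp_all)
  moreover have "(norm x)\<^sup>2 = (norm y)\<^sup>2 + 2 * (a \<bullet> y) + (norm a)\<^sup>2"
    using q[of 1] by (simp add: a_def)
  ultimately show ?thesis by (simp add: a_def)
qed

context one_forms_fibred
begin

lemma fibre_norm_L2: "(\<lambda>x. norm (U \<eta> x)) \<in> L2 M"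
  using Sec_norm[OF U_Sec] U_L2 by (simp add: L2_def)

lemma U_diff: "AE x in M. U (\<eta> - \<zeta>) x = U \<eta> x - U \<zeta> x"
proof -
  have "AE x in M. U ((\<eta> - \<zeta>) + \<zeta>) x = U (\<eta> - \<zeta>) x + U \<zeta> x" by (rule U_add)
  then show ?thesis by eventually_elim (simp add: algebra_simps)
qed

text \<open>
  On the core this is part of the description of the fibres. Both sides depend continuously on \<open>f\<close>,
  as elements of \<open>L\<^sup>1\<close>.
\<close>

lemma fibre_norm_dform:
  assumes f: "f \<in> D"
  shows "AE x in M. (norm (U (grad f) x))\<^sup>2 = \<Gamma> f f x"
proof -
  define k where "k = (\<integral>x. \<bar>\<Gamma> f f x - (norm (U (grad f) x))\<^sup>2\<bar> \<partial>M)"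
  have int: "integrable M (\<Gamma> g g)" if "g \<in> D" for g using \<Gamma>_L1 that by blast
  have bound: "k \<le> 2 * (1 + c) * E (u - f) (u - f) + 2 * E f f / c" if c: "c > 0" and u: "u \<in> core D" for u c
  proof -
    have uD: "u \<in> D" by (rule core_D[OF u])
    then have ufD: "u - f \<in> D" using f by auto
    have "(\<lambda>_. 1) \<in> Bb" by (auto simp: Bb_def)
    then have "AE x in M. U (tens1 u) x \<bullet> U (tens1 u) x = 1 * 1 * \<Gamma> u u x"
      using u by (intro U_tens)
    moreover have "AE x in M. U (grad u - grad f) x = U (grad u) x - U (grad f) x" by (rule U_diff)
    moreover note \<Gamma>_perturbation[OF uD f c]
    ultimately have "AE x in M. \<bar>\<Gamma> f f x - (norm (U (grad f) x))\<^sup>2\<bar> \<le>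
        ((1 + c) * \<Gamma> (u - f) (u - f) x + \<Gamma> f f x / c) +
        ((1 + c) * (norm (U (grad (u - f)) x))\<^sup>2 + (norm (U (grad f) x))\<^sup>2 / c)"
    proof eventually_elim
      case (elim x)
      then show ?case
        using norm_sq_perturbation[OF c, of "U (grad u) x" "U (grad f) x"]
        by (simp add: dform_diff[OF uD f] dform_core[OF u] power2_norm_eq_inner)
    qed
    then have "k \<le> (\<integral>x. ((1 + c) * \<Gamma> (u - f) (u - f) x + \<Gamma> f f x / c) +
        ((1 + c) * (norm (U (grad (u - f)) x))\<^sup>2 + (norm (U (grad f) x))\<^sup>2 / c) \<partial>M)"
      unfolding k_def
      by (intro integral_mono_AE integrable_abs Bochner_Integration.integrable_diff
          Bochner_Integration.integrable_add integrable_divide integrable_mult_right int f ufD U_L2)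
    also have "\<dots> = ((1 + c) * E (u - f) (u - f) + E f f / c) +
        ((1 + c) * (norm (grad (u - f)))\<^sup>2 + (norm (grad f))\<^sup>2 / c)"
      by (simp add: int f ufD U_L2 \<Gamma>_energy flip: U_isometric)
    also have "\<dots> = 2 * (1 + c) * E (u - f) (u - f) + 2 * E f f / c"
      using f ufD by (simp add: norm_dform energy.nrm_sq algebra_simps add_divide_distrib)
    finally show ?thesis .
  qed
  obtain u where u: "\<And>n. u n \<in> core D" "(\<lambda>n. E1norm M E (u n - f)) \<longlonglongrightarrow> 0"
    using core_dense[OF f] by blast
  have uD: "u n \<in> D" for n using u core_D by blast
  have "(\<lambda>n. (energy.nrm (u n - f))\<^sup>2) \<longlonglongrightarrow> 0\<^sup>2"
    by (intro tendsto_power tendsto_energy_nrm uD f u)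
  then have lim: "(\<lambda>n. E (u n - f) (u n - f)) \<longlonglongrightarrow> 0" using uD f by (simp add: energy.nrm_sq)
  have kc: "k \<le> 2 * E f f / c" if c: "c > 0" for c
  proof -
    have "(\<lambda>n. 2 * (1 + c) * E (u n - f) (u n - f) + 2 * E f f / c) \<longlonglongrightarrow> 2 * (1 + c) * 0 + 2 * E f f / c"
      by (intro tendsto_intros lim)
    then have "k \<le> 2 * (1 + c) * 0 + 2 * E f f / c"
      by (rule LIMSEQ_le_const) (use bound[OF c u(1)] in auto)
    then show ?thesis by simp
  qed
  have "((\<lambda>c. 2 * E f f / c) \<longlongrightarrow> 0) at_top"
    by (intro tendsto_divide_0[OF tendsto_const] filterlim_at_top_imp_at_infinity filterlim_ident)
  moreover have "eventually (\<lambda>c. k \<le> 2 * E f f / c) at_top"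
    using eventually_gt_at_top[of "0::real"] by eventually_elim (rule kc)
  ultimately have "k \<le> 0" using tendsto_lowerbound trivial_limit_at_top_linorder by blast
  moreover have "0 \<le> k" unfolding k_def by simp
  ultimately have "k = 0" by simp
  moreover have "integrable M (\<lambda>x. \<bar>\<Gamma> f f x - (norm (U (grad f) x))\<^sup>2\<bar>)"
    by (intro integrable_abs Bochner_Integration.integrable_diff int f U_L2)
  ultimately have "AE x in M. \<bar>\<Gamma> f f x - (norm (U (grad f) x))\<^sup>2\<bar> = 0"
    unfolding k_def by (subst (asm) integral_nonneg_eq_0_iff_AE) auto
  then show ?thesis by eventually_elim simp
qed

end

section \<open>The gradient estimate\<close>

theorem theorem2p4:
  fixes M :: "'a::{metric_space, second_countable_topology} measure"
    and D :: "('a \<Rightarrow> real) set"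
    and E :: "('a \<Rightarrow> real) \<Rightarrow> ('a \<Rightarrow> real) \<Rightarrow> real"
    and \<Gamma> :: "('a \<Rightarrow> real) \<Rightarrow> ('a \<Rightarrow> real) \<Rightarrow> 'a \<Rightarrow> real"
    and tens :: "('a \<Rightarrow> real) \<Rightarrow> ('a \<Rightarrow> real) \<Rightarrow> 'h::{real_inner, complete_space}"
    and Fib :: "'a \<Rightarrow> 'v::real_inner set"
    and Sec :: "('a \<Rightarrow> 'v) set"
    and U :: "'h \<Rightarrow> 'a \<Rightarrow> 'v"
    and T :: "real \<Rightarrow> ('a \<Rightarrow> real) \<Rightarrow> 'a \<Rightarrow> real"
    and S :: "real \<Rightarrow> 'h \<Rightarrow> 'h"
    and C1 :: real
  assumes setting: "one_forms_fibred M D E \<Gamma> tens Fib Sec U"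
    and heat: "l2_c0_semigroup M (laplacian M D E) T"
    and form_heat: "c0_semigroup (form_laplacian M D tens) S"
    and C1: "C1 \<ge> 1"
    and domination: "\<And>\<eta> t. 0 \<le> t \<Longrightarrow> t \<le> 1 \<Longrightarrow>
        AE x in M. norm (U (S t \<eta>) x) \<le> C1 * T t (\<lambda>y. norm (U \<eta> y)) x"
  shows "\<exists>C2 :: real. \<forall>f\<in>D. \<forall>t\<ge>0. AE x in M.
      sqrt (\<Gamma> (T t f) (T t f) x) \<le> C1 * exp (C2 * t) * T t (\<lambda>y. sqrt (\<Gamma> f f y)) x"
proof -
  interpret one_forms_fibred M D E \<Gamma> tens Fib Sec U by (rule setting)
  interpret one_forms_heat M D E \<Gamma> tens T S
    by unfold_locales (rule heat, rule form_heat)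
  \<comment> \<open>One unit step: apply the domination on \<open>[0, 1]\<close> at time \<open>1\<close>, then monotonicity of \<open>T 1\<close>.\<close>
  have iterate: "AE x in M. norm (U (S t \<eta>) x) \<le> C1 ^ Suc n * T t (\<lambda>y. norm (U \<eta> y)) x"
    if "real n \<le> t" "t \<le> real (Suc n)" for n t \<eta>
    using that
  proof (induction n arbitrary: t)
    case 0
    then show ?case using domination[of t \<eta>] by simp
  next
    case (Suc n)
    define s where "s = t - 1"
    have s: "0 \<le> s" "real n \<le> s" "s \<le> real (Suc n)" "t = 1 + s" using Suc.prems by (auto simp: s_def)
    define g where "g = (\<lambda>y. norm (U \<eta> y))"
    define k where "k = C1 ^ Suc n"
    have k: "0 \<le> k" using C1 by (simp add: k_def)
    have gL: "g \<in> L2 M" "T s g \<in> L2 M" "k *\<^sub>R T s g \<in> L2 M"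
      using s fibre_norm_L2 by (auto simp: g_def)
    have "S t \<eta> = S 1 (S s \<eta>)"
      using form_heat s unfolding c0_semigroup_def s(4) by simp
    then have "AE x in M. norm (U (S t \<eta>) x) \<le> C1 * T 1 (\<lambda>y. norm (U (S s \<eta>) y)) x"
      using domination[of 1 "S s \<eta>"] by simp
    moreover have "AE x in M. norm (U (S s \<eta>) x) \<le> (k *\<^sub>R T s g) x"
      using Suc.IH[OF s(2,3)] by (simp add: k_def g_def fun_pointwise)
    then have "AE x in M. T 1 (\<lambda>y. norm (U (S s \<eta>) y)) x \<le> T 1 (k *\<^sub>R T s g) x"
      using fibre_norm_L2 gL by (intro heat_mono) auto
    moreover have "AE x in M. T 1 (k *\<^sub>R T s g) x = k * T 1 (T s g) x"
      using heat gL unfolding l2_c0_semigroup_def by (simp add: fun_pointwise)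
    moreover have "AE x in M. T t g x = T 1 (T s g) x"
      using heat gL s unfolding l2_c0_semigroup_def by simp
    ultimately have "AE x in M. norm (U (S t \<eta>) x) \<le> C1 ^ Suc (Suc n) * T t g x"
    proof eventually_elim
      case (elim x)
      have "C1 * T 1 (\<lambda>y. norm (U (S s \<eta>) y)) x \<le> C1 * (k * T t g x)"
        using elim C1 by (intro mult_left_mono) auto
      then show ?case using elim by (simp add: k_def mult.assoc)
    qed
    then show ?case by (simp add: g_def)
  qed
  show ?thesis
  proof (intro exI[of _ "ln C1"] ballI allI impI)
    fix f and t :: real assume f: "f \<in> D" and t: "0 \<le> t"
    define n where "n = nat \<lfloor>t\<rfloor>"
    have n: "real n \<le> t" "t \<le> real (Suc n)" using t by (auto simp: n_def) linarith
    have "C1 ^ n = exp (ln C1 * real n)" using C1 by (simp add: exp_of_nat2_mult)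
    also have "\<dots> \<le> exp (ln C1 * t)" using n C1 by (simp add: mult_left_mono)
    finally have pow: "C1 ^ Suc n \<le> C1 * exp (ln C1 * t)" using C1 by simp
    define g where "g = (\<lambda>y. norm (U (grad f) y))"
    define h where "h = (\<lambda>y. sqrt (\<Gamma> f f y))"
    have gL: "g \<in> L2 M" using fibre_norm_L2 by (simp add: g_def)
    have gh: "AE x in M. h x = g x"
      using fibre_norm_dform[OF f]
    proof eventually_elim
      case (elim x)
      show ?case by (simp add: g_def h_def elim[symmetric])
    qed
    have hL: "h \<in> L2 M"
    proof (rule L2_bound[OF gL])
      have "\<Gamma> f f \<in> borel_measurable M" using \<Gamma>_L1[OF f f] by (rule borel_measurable_integrable)
      then show "h \<in> borel_measurable M" unfolding h_def by measurable
      show "AE x in M. \<bar>h x\<bar> \<le> \<bar>g x\<bar>" using gh by eventually_elim simp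
    qed
    have "AE x in M. norm (U (S t (grad f)) x) \<le> C1 ^ Suc n * T t g x"
      unfolding g_def by (rule iterate[OF n])
    moreover have "AE x in M. (norm (U (S t (grad f)) x))\<^sup>2 = \<Gamma> (T t f) (T t f) x"
      using fibre_norm_dform[OF intertwining(1)[OF f t]] intertwining(2)[OF f t] by simp
    moreover have "AE x in M. T t h x = T t g x" by (rule heat_cong[OF hL gL gh t])
    moreover have "AE x in M. 0 \<le> T t g x" by (rule heat_positive[OF gL _ t]) (simp add: g_def)
    ultimately have "AE x in M. sqrt (\<Gamma> (T t f) (T t f) x) \<le> C1 * exp (ln C1 * t) * T t h x"
    proof eventually_elim
      case (elim x)
      have "sqrt (\<Gamma> (T t f) (T t f) x) = norm (U (S t (grad f)) x)"
        using elim(2)[symmetric] by simp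
      also have "\<dots> \<le> C1 ^ Suc n * T t g x" by (rule elim(1))
      also have "\<dots> \<le> C1 * exp (ln C1 * t) * T t g x" by (rule mult_right_mono[OF pow elim(4)])
      finally show ?case using elim(3) by simp
    qed
    then show "AE x in M. sqrt (\<Gamma> (T t f) (T t f) x) \<le>
        C1 * exp (ln C1 * t) * T t (\<lambda>y. sqrt (\<Gamma> f f y)) x"
      by (simp add: h_def)
  qed
qed

end
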